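(* Let $E,F$ be Banach spaces over $\mathbb{K}$, let $n\ge 2$ be a natural number and let $0<p<\infty$. Then: (i) $[\Pi_{as(p)}](^{n}E;F)=\mathcal{L}_{as(p;p,\infty,\dots,\infty)}(^{n}E;F)\cap\dots\cap\mathcal{L}_{as(p;\infty,\dots,\infty,p)}(^{n}E;F)$, the intersection of the $n$ classes in which exactly one of the $n$ indices after the semicolon is $p$ and all others are $\infty$. (ii) $\mathcal{L}_{d,p}(^{n}E;F)\subset\mathcal{L}_{si,p}(^{n}E;F)\subset[\Pi_{as(p)}](^{n}E;F)$. (iii) $\mathcal{L}_{si,p}(^{n}E;F)\subset\mathcal{L}_{d,np}(^{n}E;F)$. (iv) $\mathcal{L}_{si,p}(^{n}E;F)\subset\mathcal{L}_{fas,p}(^{n}E;F)\subset\mathcal{L}_{as,p}^{ev}(^{n}E;F)\subset\mathcal{L}_{as,p}(^{n}E;F)$. (v) $\mathcal{L}_{si,p}(^{n}E;F)\subset\mathcal{L}_{sas,p}(^{n}E;F)$.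
   Context: $\mathbb{K}=\mathbb{R}$ or $\mathbb{C}$; $E'$ is the dual and $B_X$ the closed unit ball of $X$. $\mathcal{L}(E_1,\dots,E_n;F)$ is the Banach space of continuous $n$-linear maps $E_1\times\dots\times E_n\to F$ with the sup norm; for every class below, writing $(^nE;F)$ means $E_1=\dots=E_n=E$. For $0<p<\infty$, $l_p(E)$ is the space of sequences in $E$ with $\|(x_j)\|_p=(\sum_j\|x_j\|^p)^{1/p}<\infty$, and $l_p^w(E)$ is the space of sequences in $E$ with $(\varphi(x_j))_j\in l_p$ for all $\varphi\in E'$, with $\|(x_j)\|_{w,p}=\sup_{\varphi\in B_{E'}}\|(\varphi(x_j))_j\|_p$. For $p=\infty$, $l_\infty^w(E)=l_\infty(E)$ is the space of bounded sequences with the sup norm. A linear operator $u$ is absolutely $p$-summing if it maps sequences in $l_p^w$ to sequences in $l_p$. Let $T\in\mathcal{L}(E_1,\dots,E_n;F)$. All balls $B_{E_j'}$ carry the weak-star topology. - $T$ is $p$-dominated ($T\in\mathcal{L}_{d,p}$) if there are $C\ge0$ and regular Borel probability measures $\mu_j$ on $B_{E_j'}$ with $\|T(x_1,\dots,x_n)\|\le C\prod_{j=1}^n\left[\int_{B_{E_j'}}|\varphi(x_j)|^p\,d\mu_j(\varphi)\right]^{1/p}$ for all $x_j\in E_j$. - $T\in[\Pi_{as(p)}]$ (absolutely $p$-summing type) if for every $j\in\{1,\dots,n\}$ the linear operator $\Psi_j^{(n)}(T):E_j\to\mathcal{L}(E_1,\dots,E_{j-1},E_{j+1},\dots,E_n;F)$,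 $\Psi_j^{(n)}(T)(x_j)(x_1,\dots,x_{j-1},x_{j+1},\dots,x_n)=T(x_1,\dots,x_n)$, is absolutely $p$-summing. - $T$ is $p$-semi-integral ($T\in\mathcal{L}_{si,p}$) if there are $C\ge0$ and a regular Borel probability measure $\mu$ on $B_{E_1'}\times\dots\times B_{E_n'}$ with $\|T(x_1,\dots,x_n)\|\le C\left(\int|\varphi_1(x_1)\cdots\varphi_n(x_n)|^p\,d\mu(\varphi_1,\dots,\varphi_n)\right)^{1/p}$ for all $x_j\in E_j$. - $T$ is fully $p$-summing ($T\in\mathcal{L}_{fas,p}$) if there is $C>0$ with $\left(\sum_{j_1,\dots,j_n=1}^\infty\|T(x_{j_1}^{(1)},\dots,x_{j_n}^{(n)})\|^p\right)^{1/p}\le C\prod_{k=1}^n\|(x_j^{(k)})_{j}\|_{w,p}$ for all $(x_j^{(k)})_{j}\in l_p^w(E_k)$, $k=1,\dots,n$. - $T$ is strongly $p$-summing ($T\in\mathcal{L}_{sas,p}$) if there are $C\ge0$ and a regular Borel probability measure $\mu$ on $B_{\mathcal{L}(E_1,\dots,E_n;\mathbb{K})}$, with the weak-star topology ($\mathcal{L}(E_1,\dots,E_n;\mathbb{K})$ being the dual of the completed projective tensor product of $E_1,\dots,E_n$), such that $\|T(x_1,\dots,x_n)\|\le C\left(\int|\phi(x_1,\dots,x_n)|^p\,d\mu(\phi)\right)^{1/p}$ for all $x_j\in E_j$. - $T$ is $(p;q_1,\dots,q_n)$-summing at $(a_1,\dots,a_n)\in E_1\times\dots\times E_n$ if $(T(a_1+x_j^{(1)},\dots,a_n+x_j^{(n)})-T(a_1,\dots,a_n))_{j}\in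 l_p(F)$ whenever $(x_j^{(s)})_{j}\in l_{q_s}^w(E_s)$, $s=1,\dots,n$. $\mathcal{L}_{as(p;q_1,\dots,q_n)}$ is the class of maps with this property at $(0,\dots,0)$, and $\mathcal{L}^{ev}_{as(p;q_1,\dots,q_n)}$ the class of those with this property at every point. If $q_1=\dots=q_n=p$ one writes $\mathcal{L}_{as,p}$ and $\mathcal{L}_{as,p}^{ev}$. *)

theory Defs
  imports "HOL-Probability.Probability"
begin

section \<open>Scalars and Banach spaces over them\<close>

text \<open>The scalar field is a type that is isometrically isomorphic to the reals or to the
  complex numbers, so that both cases are covered by one type variable.\<close>

class real_or_complex = real_normed_field +
  assumes ex_isometry_real_or_complex:
    "\<exists>f :: 'a \<Rightarrow> complex. f 1 = 1 \<and> (\<forall>x y. f (x + y) = f x + f y) \<and> (\<forall>x y. f (x * y) = f x * f y) \<and>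
       (\<forall>x. norm (f x) = norm x) \<and> (range f = \<real> \<or> range f = UNIV)"

instance real :: real_or_complex
  by standard (rule exI[of _ complex_of_real], auto simp: Reals_def)

instance complex :: real_or_complex
  by standard (rule exI[of _ id], auto)

text \<open>The library has no class of Banach spaces over a variable field: the scalar multiplication
  is a parameter \<open>s\<close>, and the real Banach space structure carried by the type is its restriction
  to real scalars.\<close>

locale banach_over = vector_space s
  for s :: "'k::real_or_complex \<Rightarrow> 'e::banach \<Rightarrow> 'e" +
  assumes norm_scale: "norm (s c x) = norm c * norm x"
    and scale_of_real: "s (of_real r) x = r *\<^sub>R x"

lemma banach_over_scaleR: "banach_over ((*\<^sub>R) :: real \<Rightarrow> 'e::banach \<Rightarrow> 'e)"
  by unfold_locales (auto simp: scaleR_add_right scaleR_add_left)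

lemma banach_over_complex: "banach_over ((*) :: complex \<Rightarrow> complex \<Rightarrow> complex)"
  by unfold_locales (auto simp: norm_mult scaleR_conv_of_real algebra_simps)


section \<open>Continuous multilinear maps and duals\<close>

text \<open>Elements of a power of the space indexed by a finite set \<open>I\<close> of naturals are functions on
  \<open>nat\<close> of which only the coordinates in \<open>I\<close> matter; the first condition makes
  a multilinear map depend on these coordinates only.  For \<open>I = {..<n}\<close> these are the
  \<open>n\<close>-linear maps, and removing an index \<open>j\<close> from \<open>I\<close> drops the \<open>j\<close>-th factor.\<close>

definition multilinear_maps ::
  "('k::field \<Rightarrow> 'e::ab_group_add \<Rightarrow> 'e) \<Rightarrow> ('k \<Rightarrow> 'f::ab_group_add \<Rightarrow> 'f) \<Rightarrow> nat set \<Rightarrow> ((nat \<Rightarrow> 'e) \<Rightarrow> 'f) set" where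
  "multilinear_maps sE sF I =
     {T. (\<forall>x. T (restrict x I) = T x) \<and>
         (\<forall>i\<in>I. \<forall>x. Vector_Spaces.linear sE sF (\<lambda>y. T (x(i := y))))}"

definition cont_multilinear_maps ::
  "('k::field \<Rightarrow> 'e::real_normed_vector \<Rightarrow> 'e) \<Rightarrow> ('k \<Rightarrow> 'f::real_normed_vector \<Rightarrow> 'f) \<Rightarrow> nat set
     \<Rightarrow> ((nat \<Rightarrow> 'e) \<Rightarrow> 'f) set" where
  "cont_multilinear_maps sE sF I =
     {T \<in> multilinear_maps sE sF I. continuous_map (product_topology (\<lambda>_. euclidean) I) euclidean T}"

definition multilinear_norm :: "nat set \<Rightarrow> ((nat \<Rightarrow> 'e::real_normed_vector) \<Rightarrow> 'f::real_normed_vector) \<Rightarrow> real" where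
  "multilinear_norm I T = (SUP x\<in>{x. \<forall>i\<in>I. norm (x i) \<le> 1}. norm (T x))"

definition dual_space :: "('k::real_normed_field \<Rightarrow> 'e::real_normed_vector \<Rightarrow> 'e) \<Rightarrow> ('e \<Rightarrow> 'k) set" where
  "dual_space sE = {\<phi>. Vector_Spaces.linear sE (*) \<phi> \<and> continuous_on UNIV \<phi>}"

definition dual_ball :: "('k::real_normed_field \<Rightarrow> 'e::real_normed_vector \<Rightarrow> 'e) \<Rightarrow> ('e \<Rightarrow> 'k) set" where
  "dual_ball sE = {\<phi> \<in> dual_space sE. onorm \<phi> \<le> 1}"

definition multiform_ball ::
  "('k::real_normed_field \<Rightarrow> 'e::real_normed_vector \<Rightarrow> 'e) \<Rightarrow> nat set \<Rightarrow> ((nat \<Rightarrow> 'e) \<Rightarrow> 'k) set" where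
  "multiform_ball sE I = {\<phi> \<in> cont_multilinear_maps sE (*) I. multilinear_norm I \<phi> \<le> 1}"


section \<open>Weak-star topologies\<close>

text \<open>The coarsest topology on \<open>X\<close> that makes every map in the (nonempty) set \<open>G\<close> continuous.\<close>

definition initial_topology :: "'a set \<Rightarrow> ('a \<Rightarrow> 'b::topological_space) set \<Rightarrow> 'a topology" where
  "initial_topology X G = topology_generated_by {{\<phi>\<in>X. g \<phi> \<in> U} | g U. g \<in> G \<and> open U}"

definition dual_ball_topology ::
  "('k::real_normed_field \<Rightarrow> 'e::real_normed_vector \<Rightarrow> 'e) \<Rightarrow> ('e \<Rightarrow> 'k) topology" where
  "dual_ball_topology sE =
     subtopology (initial_topology (dual_space sE) (range (\<lambda>x \<phi>. \<phi> x))) (dual_ball sE)"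

text \<open>A list \<open>[(c\<^sub>1, x\<^sub>1), \<dots>, (c\<^sub>m, x\<^sub>m)]\<close> represents the tensor \<open>\<Sum>i. c\<^sub>i x\<^sub>i(0) \<otimes> \<dots> \<otimes> x\<^sub>i(n-1)\<close>.
  Elementary tensors are evaluation functionals on the (not necessarily continuous) multilinear
  forms, so two lists represent the same tensor if all these forms agree on them.
  Elements of the completed projective tensor product are represented by sequences that are Cauchy
  for the projective norm, and a continuous multilinear form acts on them by taking limits.\<close>

type_synonym ('k, 'e) formal_tensor = "('k \<times> (nat \<Rightarrow> 'e)) list"

definition tensor_eval :: "((nat \<Rightarrow> 'e) \<Rightarrow> 'k::field) \<Rightarrow> ('k, 'e) formal_tensor \<Rightarrow> 'k" where
  "tensor_eval A u = (\<Sum>(c, x)\<leftarrow>u. c * A x)"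

definition tensor_eq ::
  "('k::field \<Rightarrow> 'e::ab_group_add \<Rightarrow> 'e) \<Rightarrow> nat set \<Rightarrow> ('k, 'e) formal_tensor \<Rightarrow> ('k, 'e) formal_tensor \<Rightarrow> bool" where
  "tensor_eq sE I u v \<longleftrightarrow> (\<forall>A\<in>multilinear_maps sE (*) I. tensor_eval A u = tensor_eval A v)"

definition tensor_diff :: "('k::field, 'e) formal_tensor \<Rightarrow> ('k, 'e) formal_tensor \<Rightarrow> ('k, 'e) formal_tensor" where
  "tensor_diff u v = u @ map (\<lambda>(c, x). (- c, x)) v"

definition projective_norm ::
  "('k::real_normed_field \<Rightarrow> 'e::real_normed_vector \<Rightarrow> 'e) \<Rightarrow> nat set \<Rightarrow> ('k, 'e) formal_tensor \<Rightarrow> real" where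
  "projective_norm sE I u =
     Inf {(\<Sum>(c, x)\<leftarrow>v. norm c * (\<Prod>i\<in>I. norm (x i))) | v. tensor_eq sE I u v}"

definition projective_Cauchy ::
  "('k::real_normed_field \<Rightarrow> 'e::real_normed_vector \<Rightarrow> 'e) \<Rightarrow> nat set \<Rightarrow> (nat \<Rightarrow> ('k, 'e) formal_tensor) \<Rightarrow> bool" where
  "projective_Cauchy sE I u \<longleftrightarrow>
     (\<forall>\<epsilon>>0. \<exists>N. \<forall>k\<ge>N. \<forall>l\<ge>N. projective_norm sE I (tensor_diff (u k) (u l)) < \<epsilon>)"

definition multiform_ball_topology ::
  "('k::real_normed_field \<Rightarrow> 'e::real_normed_vector \<Rightarrow> 'e) \<Rightarrow> nat set \<Rightarrow> ((nat \<Rightarrow> 'e) \<Rightarrow> 'k) topology" where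
  "multiform_ball_topology sE I =
     subtopology
       (initial_topology (cont_multilinear_maps sE (*) I)
         {\<lambda>\<phi>. lim (\<lambda>m. tensor_eval \<phi> (u m)) | u. projective_Cauchy sE I u})
       (multiform_ball sE I)"


section \<open>Regular Borel probability measures\<close>

definition regular_borel_prob :: "'a topology \<Rightarrow> 'a measure \<Rightarrow> bool" where
  "regular_borel_prob X M \<longleftrightarrow>
     prob_space M \<and> space M = topspace X \<and> sets M = sigma_sets (topspace X) {U. openin X U} \<and>
     (\<forall>A\<in>sets M. emeasure M A = (INF U\<in>{U. openin X U \<and> A \<subseteq> U}. emeasure M U) \<and>
                  emeasure M A = (SUP K\<in>{K. compactin X K \<and> K \<subseteq> A}. emeasure M K))"


section \<open>Sequence spaces\<close>

text \<open>The norm is a parameter because \<open>lp\<close> is also used for spaces of multilinear maps, which are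
  not types.\<close>

definition lp :: "('g \<Rightarrow> real) \<Rightarrow> real \<Rightarrow> (nat \<Rightarrow> 'g) set" where
  "lp nrm p = {x. summable (\<lambda>j. nrm (x j) powr p)}"

definition lp_norm :: "('g \<Rightarrow> real) \<Rightarrow> real \<Rightarrow> (nat \<Rightarrow> 'g) \<Rightarrow> real" where
  "lp_norm nrm p x = (\<Sum>j. nrm (x j) powr p) powr (1 / p)"

definition weak_lp ::
  "('k::real_normed_field \<Rightarrow> 'e::real_normed_vector \<Rightarrow> 'e) \<Rightarrow> ereal \<Rightarrow> (nat \<Rightarrow> 'e) set" where
  "weak_lp sE q =
     (if q = \<infinity> then {x. bounded (range x)}
      else {x. \<forall>\<phi>\<in>dual_space sE. (\<lambda>j. \<phi> (x j)) \<in> lp norm (real_of_ereal q)})"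

text \<open>For \<open>x\<close> in \<open>weak_lp sE p\<close> with \<open>0 < p\<close>, the supremum is over a bounded set
  (by the Baire category theorem in the dual), so it is a genuine real supremum.\<close>

definition weak_lp_norm ::
  "('k::real_normed_field \<Rightarrow> 'e::real_normed_vector \<Rightarrow> 'e) \<Rightarrow> real \<Rightarrow> (nat \<Rightarrow> 'e) \<Rightarrow> real" where
  "weak_lp_norm sE p x = (SUP \<phi>\<in>dual_ball sE. lp_norm norm p (\<lambda>j. \<phi> (x j)))"


section \<open>Classes of multilinear maps\<close>

definition dominated_maps ::
  "('k::real_or_complex \<Rightarrow> 'e::banach \<Rightarrow> 'e) \<Rightarrow> ('k \<Rightarrow> 'f::banach \<Rightarrow> 'f) \<Rightarrow> nat \<Rightarrow> real \<Rightarrow> ((nat \<Rightarrow> 'e) \<Rightarrow> 'f) set" where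
  "dominated_maps sE sF n p =
     {T \<in> cont_multilinear_maps sE sF {..<n}.
        \<exists>C\<ge>0. \<exists>\<mu>. (\<forall>j<n. regular_borel_prob (dual_ball_topology sE) (\<mu> j)) \<and>
          (\<forall>x. norm (T x) \<le> C * (\<Prod>j<n. (\<integral>\<phi>. norm (\<phi> (x j)) powr p \<partial>\<mu> j) powr (1 / p)))}"

definition absolutely_summing ::
  "('k::real_normed_field \<Rightarrow> 'e::real_normed_vector \<Rightarrow> 'e) \<Rightarrow> ('g \<Rightarrow> real) \<Rightarrow> real \<Rightarrow> ('e \<Rightarrow> 'g) \<Rightarrow> bool" where
  "absolutely_summing sE nrm p u \<longleftrightarrow> (\<forall>x\<in>weak_lp sE (ereal p). (\<lambda>j. u (x j)) \<in> lp nrm p)"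

definition separate_var :: "nat \<Rightarrow> ((nat \<Rightarrow> 'e) \<Rightarrow> 'f) \<Rightarrow> 'e \<Rightarrow> (nat \<Rightarrow> 'e) \<Rightarrow> 'f" where
  "separate_var j T y = (\<lambda>x. T (x(j := y)))"

definition summing_type_maps ::
  "('k::real_or_complex \<Rightarrow> 'e::banach \<Rightarrow> 'e) \<Rightarrow> ('k \<Rightarrow> 'f::banach \<Rightarrow> 'f) \<Rightarrow> nat \<Rightarrow> real \<Rightarrow> ((nat \<Rightarrow> 'e) \<Rightarrow> 'f) set" where
  "summing_type_maps sE sF n p =
     {T \<in> cont_multilinear_maps sE sF {..<n}.
        \<forall>j<n. absolutely_summing sE (multilinear_norm ({..<n} - {j})) p (separate_var j T)}"

definition semi_integral_maps ::
  "('k::real_or_complex \<Rightarrow> 'e::banach \<Rightarrow> 'e) \<Rightarrow> ('k \<Rightarrow> 'f::banach \<Rightarrow> 'f) \<Rightarrow> nat \<Rightarrow> real \<Rightarrow> ((nat \<Rightarrow> 'e) \<Rightarrow> 'f) set" where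
  "semi_integral_maps sE sF n p =
     {T \<in> cont_multilinear_maps sE sF {..<n}.
        \<exists>C\<ge>0. \<exists>\<mu>. regular_borel_prob (product_topology (\<lambda>_. dual_ball_topology sE) {..<n}) \<mu> \<and>
          (\<forall>x. norm (T x) \<le> C * (\<integral>\<phi>. norm (\<Prod>j<n. \<phi> j (x j)) powr p \<partial>\<mu>) powr (1 / p))}"

definition fully_summing_maps ::
  "('k::real_or_complex \<Rightarrow> 'e::banach \<Rightarrow> 'e) \<Rightarrow> ('k \<Rightarrow> 'f::banach \<Rightarrow> 'f) \<Rightarrow> nat \<Rightarrow> real \<Rightarrow> ((nat \<Rightarrow> 'e) \<Rightarrow> 'f) set" where
  "fully_summing_maps sE sF n p =
     {T \<in> cont_multilinear_maps sE sF {..<n}.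
        \<exists>C>0. \<forall>x. (\<forall>k<n. x k \<in> weak_lp sE (ereal p)) \<longrightarrow>
          (\<lambda>j. norm (T (\<lambda>k. x k (j k))) powr p) summable_on ({..<n} \<rightarrow>\<^sub>E UNIV) \<and>
          (\<Sum>\<^sub>\<infinity>j\<in>{..<n} \<rightarrow>\<^sub>E UNIV. norm (T (\<lambda>k. x k (j k))) powr p) powr (1 / p)
            \<le> C * (\<Prod>k<n. weak_lp_norm sE p (x k))}"

definition strongly_summing_maps ::
  "('k::real_or_complex \<Rightarrow> 'e::banach \<Rightarrow> 'e) \<Rightarrow> ('k \<Rightarrow> 'f::banach \<Rightarrow> 'f) \<Rightarrow> nat \<Rightarrow> real \<Rightarrow> ((nat \<Rightarrow> 'e) \<Rightarrow> 'f) set" where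
  "strongly_summing_maps sE sF n p =
     {T \<in> cont_multilinear_maps sE sF {..<n}.
        \<exists>C\<ge>0. \<exists>\<mu>. regular_borel_prob (multiform_ball_topology sE {..<n}) \<mu> \<and>
          (\<forall>x. norm (T x) \<le> C * (\<integral>\<phi>. norm (\<phi> x) powr p \<partial>\<mu>) powr (1 / p))}"

definition summing_at ::
  "('k::real_or_complex \<Rightarrow> 'e::banach \<Rightarrow> 'e) \<Rightarrow> nat \<Rightarrow> real \<Rightarrow> (nat \<Rightarrow> ereal) \<Rightarrow> ((nat \<Rightarrow> 'e) \<Rightarrow> 'f::banach)
     \<Rightarrow> (nat \<Rightarrow> 'e) \<Rightarrow> bool" where
  "summing_at sE n p q T a \<longleftrightarrow>
     (\<forall>x. (\<forall>s<n. x s \<in> weak_lp sE (q s)) \<longrightarrow> (\<lambda>j. T (\<lambda>s. a s + x s j) - T a) \<in> lp norm p)"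

definition as_maps ::
  "('k::real_or_complex \<Rightarrow> 'e::banach \<Rightarrow> 'e) \<Rightarrow> ('k \<Rightarrow> 'f::banach \<Rightarrow> 'f) \<Rightarrow> nat \<Rightarrow> real \<Rightarrow> (nat \<Rightarrow> ereal)
     \<Rightarrow> ((nat \<Rightarrow> 'e) \<Rightarrow> 'f) set" where
  "as_maps sE sF n p q =
     {T \<in> cont_multilinear_maps sE sF {..<n}. summing_at sE n p q T (\<lambda>_. 0)}"

definition as_ev_maps ::
  "('k::real_or_complex \<Rightarrow> 'e::banach \<Rightarrow> 'e) \<Rightarrow> ('k \<Rightarrow> 'f::banach \<Rightarrow> 'f) \<Rightarrow> nat \<Rightarrow> real \<Rightarrow> (nat \<Rightarrow> ereal)
     \<Rightarrow> ((nat \<Rightarrow> 'e) \<Rightarrow> 'f) set" where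
  "as_ev_maps sE sF n p q =
     {T \<in> cont_multilinear_maps sE sF {..<n}. \<forall>a. summing_at sE n p q T a}"

end

theory Submission
  imports Defs
begin

text \<open>
  For the inclusion of the dominated maps in the semi-integral ones, the Borel
  \<open>\<sigma>\<close>-algebra of a product of non-metrizable spaces is too large for the usual product measure.
  However, for an open set \<open>U\<close> of \<open>X \<times> Y\<close> the measure of the section of \<open>U\<close> at \<open>y\<close> is lower
  semicontinuous in \<open>y\<close>, by inner regularity and the tube lemma, so iterated integration defines a
  Borel measure on the product, and the same two facts show that it is regular.  Conversely, Hoelder's
  inequality and the marginals of the measure take a \<open>p\<close>-semi-integral map to an
  \<open>np\<close>-dominated one.

  Images of regular measures under continuous maps into Hausdorff spaces are regular, and
  \<open>(\<phi>\<^sub>1, \<dots>, \<phi>\<^sub>n) \<mapsto> \<phi>\<^sub>1 \<otimes> \<dots> \<otimes> \<phi>\<^sub>n\<close> is weak-star continuous, which gives strong summability.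

  Summability of semi-integral maps results from integrating the sums
  \<open>\<Sum>\<^sub>m |\<phi>(x\<^sub>m)|\<^sup>p\<close>, which are bounded uniformly on the dual ball by Baire's theorem.  A fully
  summing map is summing at every point \<open>a\<close> by expanding \<open>T(a + x\<^sub>m) - T(a)\<close> and testing each
  term on sequences of the form \<open>(a\<^sub>i, 0, 0, \<dots>)\<close>.
\<close>

section \<open>Regular Borel measures on Hausdorff spaces\<close>

text \<open>The delicate point about products is regularity. Lower semicontinuity bounds the measure
  of a section from below near a point but never from above, so a compact tube found at one point
  need not serve its neighbours. Cutting the second factor into thin level sets of the section
  measure, and shrinking these to compact sets, restores the upper bound; finitely many tubes then
  give one compact subset of the given open set.

  Exponents below 1 shape the summability arguments: the \<open>p\<close>-sums are then not norms.
  Baire's theorem is therefore applied directly to the sets on which all partial sums stay below a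
  constant, and an inequality with factor \<open>2 powr p\<close> replaces the triangle inequality.

  Weak-star continuity of the tensor map has to be tested on the completed projective tensor
  product, hence on limits; the projective norm controls the values uniformly in the functionals, so
  these limits are uniform.

  For the absolutely summing type, operator norms are nearly attained at points of unit balls, and
  such points form bounded sequences, exactly what the index \<open>\<infinity>\<close>
  admits.\<close>

definition borel_of :: "'a topology \<Rightarrow> 'a measure" where
  "borel_of X = sigma (topspace X) {U. openin X U}"

lemma openin_Pow: "{U. openin X U} \<subseteq> Pow (topspace X)"
  using openin_subset by auto

lemma space_borel_of [simp]: "space (borel_of X) = topspace X"
  by (simp add: borel_of_def space_measure_of[OF openin_Pow])

lemma sets_borel_of: "sets (borel_of X) = sigma_sets (topspace X) {U. openin X U}"
  by (simp add: borel_of_def sets_measure_of[OF openin_Pow])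

lemma openin_sets_borel_of: "openin X U \<Longrightarrow> U \<in> sets (borel_of X)"
  by (auto simp: sets_borel_of)

lemma closedin_sets_borel_of: "closedin X C \<Longrightarrow> C \<in> sets (borel_of X)"
  by (metis openin_sets_borel_of closedin_def double_diff order_refl sets.compl_sets space_borel_of)

lemma compactin_sets_borel_of: "Hausdorff_space X \<Longrightarrow> compactin X K \<Longrightarrow> K \<in> sets (borel_of X)"
  by (simp add: closedin_sets_borel_of compactin_imp_closedin)

lemma continuous_map_measurable_borel_of:
  assumes "continuous_map X Y f"
  shows "f \<in> borel_of X \<rightarrow>\<^sub>M borel_of Y"
proof (rule measurable_sigma_sets[OF sets_borel_of openin_Pow])
  show "f \<in> space (borel_of X) \<rightarrow> topspace Y"
    using assms by (auto simp: continuous_map_def)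
  show "f -` U \<inter> space (borel_of X) \<in> sets (borel_of X)" if "U \<in> {U. openin Y U}" for U
  proof -
    have "f -` U \<inter> space (borel_of X) = {x \<in> topspace X. f x \<in> U}" by auto
    then show ?thesis
      using that assms by (simp add: openin_continuous_map_preimage openin_sets_borel_of)
  qed
qed

lemma continuous_map_borel_measurable:
  fixes f :: "'a \<Rightarrow> 'b::topological_space"
  assumes "continuous_map X euclidean f"
  shows "f \<in> borel_measurable (borel_of X)"
proof (rule borel_measurableI)
  fix S :: "'b set" assume "open S"
  have "f -` S \<inter> space (borel_of X) = {x \<in> topspace X. f x \<in> S}" by auto
  then show "f -` S \<inter> space (borel_of X) \<in> sets (borel_of X)"
    using assms \<open>open S\<close> by (simp add: openin_continuous_map_preimage openin_sets_borel_of)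
qed

lemma regular_borel_probD:
  assumes "regular_borel_prob X M"
  shows "prob_space M" "sets M = sets (borel_of X)" "space M = topspace X"
proof -
  note * = assms[unfolded regular_borel_prob_def]
  show "prob_space M" by (rule *[THEN conjunct1])
  show "space M = topspace X" by (rule *[THEN conjunct2, THEN conjunct1])
  show "sets M = sets (borel_of X)"
    unfolding sets_borel_of by (rule *[THEN conjunct2, THEN conjunct2, THEN conjunct1])
qed

section \<open>Criteria for regularity and images under continuous maps\<close>

lemma regular_borel_prob_inner:
  assumes M: "regular_borel_prob X M" and A: "A \<in> sets M" and "0 < e"
  obtains K where "compactin X K" "K \<subseteq> A" "measure M A < measure M K + e"
proof -
  interpret prob_space M using regular_borel_probD[OF M] by simp
  have "\<exists>K. compactin X K \<and> K \<subseteq> A \<and> measure M A < measure M K + e"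
  proof (rule ccontr)
    assume "\<not> ?thesis"
    then have *: "measure M K \<le> measure M A - e" if "compactin X K" "K \<subseteq> A" for K
      using that by (meson diff_le_eq leI le_diff_eq)
    \<comment> \<open>The empty compact set gives nonnegativity, which allows the bound on the
      supremum to be moved back from \<open>ennreal\<close> to the reals.\<close>
    have 0: "0 \<le> measure M A - e"
      using *[of "{}"] by auto
    have "emeasure M A = (SUP K\<in>{K. compactin X K \<and> K \<subseteq> A}. emeasure M K)"
      using M[unfolded regular_borel_prob_def, THEN conjunct2, THEN conjunct2, THEN conjunct2, rule_format, OF A]
      by (rule conjunct2)
    also have "\<dots> \<le> ennreal (measure M A - e)"
      using * by (intro SUP_least) (auto simp: emeasure_eq_measure intro!: ennreal_leI)
    finally have "measure M A \<le> measure M A - e"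
      using 0 by (simp add: emeasure_eq_measure)
    then show False using \<open>0 < e\<close> by simp
  qed
  then show thesis using that by blast
qed

text \<open>In a Hausdorff space outer regularity of a finite measure follows from inner regularity of
  the complements.\<close>

lemma regular_borel_probI:
  assumes X: "Hausdorff_space X" and M: "prob_space M" "sets M = sets (borel_of X)"
    and inner: "\<And>A e. A \<in> sets M \<Longrightarrow> 0 < e \<Longrightarrow>
      \<exists>K. compactin X K \<and> K \<subseteq> A \<and> measure M A < measure M K + e"
  shows "regular_borel_prob X M"
proof -
  interpret prob_space M by fact
  have sp: "space M = topspace X" using sets_eq_imp_space_eq[OF M(2)] by simp
  have outer: "emeasure M A = (INF U\<in>{U. openin X U \<and> A \<subseteq> U}. emeasure M U)" if A: "A \<in> sets M" for A
  proof (rule antisym)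
    show "emeasure M A \<le> (INF U\<in>{U. openin X U \<and> A \<subseteq> U}. emeasure M U)"
      using M(2) openin_sets_borel_of by (intro INF_greatest emeasure_mono) auto
    show "(INF U\<in>{U. openin X U \<and> A \<subseteq> U}. emeasure M U) \<le> emeasure M A"
    proof (rule ennreal_le_epsilon)
      fix e :: real assume "0 < e"
      then obtain K where K: "compactin X K" "K \<subseteq> space M - A"
        "measure M (space M - A) < measure M K + e"
        using inner[of "space M - A"] A by auto
      have KM: "K \<in> sets M" using K X M(2) compactin_sets_borel_of by metis
      have "openin X (space M - K)"
        using K X sp by (simp add: compactin_imp_closedin openin_diff)
      moreover have "A \<subseteq> space M - K" using K A sets.sets_into_space by blast
      ultimately have "(INF U\<in>{U. openin X U \<and> A \<subseteq> U}. emeasure M U) \<le> emeasure M (space M - K)"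
        by (intro INF_lower) auto
      also have "\<dots> \<le> ennreal (measure M A + e)"
        using K(3) A KM by (auto simp: emeasure_eq_measure prob_compl intro!: ennreal_leI)
      also have "\<dots> = emeasure M A + ennreal e"
        using \<open>0 < e\<close> by (simp add: emeasure_eq_measure)
      finally show "(INF U\<in>{U. openin X U \<and> A \<subseteq> U}. emeasure M U) \<le> emeasure M A + ennreal e" .
    qed
  qed
  have inner: "emeasure M A = (SUP K\<in>{K. compactin X K \<and> K \<subseteq> A}. emeasure M K)"
    if A: "A \<in> sets M" for A
  proof (rule antisym)
    show "(SUP K\<in>{K. compactin X K \<and> K \<subseteq> A}. emeasure M K) \<le> emeasure M A"
      using A by (intro SUP_least emeasure_mono) auto
    show "emeasure M A \<le> (SUP K\<in>{K. compactin X K \<and> K \<subseteq> A}. emeasure M K)"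
    proof (rule ennreal_le_epsilon)
      fix e :: real assume "0 < e"
      then obtain K where K: "compactin X K" "K \<subseteq> A" "measure M A < measure M K + e"
        using inner[of A] A by auto
      have "emeasure M A \<le> emeasure M K + ennreal e"
        using K(3) \<open>0 < e\<close>
        by (simp add: emeasure_eq_measure ennreal_leI flip: ennreal_plus)
      also have "\<dots> \<le> (SUP K\<in>{K. compactin X K \<and> K \<subseteq> A}. emeasure M K) + ennreal e"
        using K by (intro add_right_mono SUP_upper) auto
      finally show "emeasure M A \<le> (SUP K\<in>{K. compactin X K \<and> K \<subseteq> A}. emeasure M K) + ennreal e" .
    qed
  qed
  show ?thesis
    unfolding regular_borel_prob_def
    by (rule conjI[OF M(1)], rule conjI[OF sp], rule conjI[OF M(2)[unfolded sets_borel_of]],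
        rule ballI, rule conjI[OF outer inner])
qed

text \<open>A compact set \<open>K\<close> that nearly exhausts the preimage of \<open>A\<close> has
  a compact image inside \<open>A\<close>, and the preimage of that image contains \<open>K\<close>,
  so no measure is lost. In a Hausdorff target the image is closed, hence Borel.\<close>

lemma regular_borel_prob_distr:
  assumes M: "regular_borel_prob X M" and f: "continuous_map X Y f" and Y: "Hausdorff_space Y"
  shows "regular_borel_prob Y (distr M (borel_of Y) f)"
proof (rule regular_borel_probI[OF Y])
  note MD = regular_borel_probD[OF M]
  interpret prob_space M by fact
  have fm: "f \<in> M \<rightarrow>\<^sub>M borel_of Y"
    using continuous_map_measurable_borel_of[OF f] MD measurable_cong_sets by blast
  show "prob_space (distr M (borel_of Y) f)" by (rule prob_space_distr[OF fm])
  fix A and e :: real assume A: "A \<in> sets (distr M (borel_of Y) f)" and "0 < e"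
  then have "f -` A \<inter> space M \<in> sets M" using fm measurable_sets by auto
  from regular_borel_prob_inner[OF M this \<open>0 < e\<close>] obtain K where
    K: "compactin X K" "K \<subseteq> f -` A \<inter> space M"
       "measure M (f -` A \<inter> space M) < measure M K + e" by blast
  have fK: "compactin Y (f ` K)" using K f image_compactin by blast
  have "measure M K \<le> measure M (f -` (f ` K) \<inter> space M)"
    using K fm compactin_sets_borel_of[OF Y fK] by (intro finite_measure_mono) auto
  then have "measure (distr M (borel_of Y) f) A < measure (distr M (borel_of Y) f) (f ` K) + e"
    using K A fm compactin_sets_borel_of[OF Y fK] by (simp add: measure_distr)
  then show "\<exists>K. compactin Y K \<and> K \<subseteq> A \<and>
      measure (distr M (borel_of Y) f) A < measure (distr M (borel_of Y) f) K + e"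
    using K fK by blast
qed simp

text \<open>The sets that can be squeezed between a closed and an open set with arbitrarily small
  difference form a sigma-algebra, and it contains the open sets because their compact approximants
  are closed. One compact set of nearly full measure then turns closed inner approximations into
  compact ones. This reduces regularity of the product measure to open sets, for which
  semicontinuity of the sections is available.\<close>

lemma regular_borel_probI_open:
  assumes X: "Hausdorff_space X" and M: "prob_space M" "sets M = sets (borel_of X)"
    and inner: "\<And>U e. openin X U \<Longrightarrow> 0 < e \<Longrightarrow>
      \<exists>K. compactin X K \<and> K \<subseteq> U \<and> measure M U < measure M K + e"
  shows "regular_borel_prob X M"
proof (rule regular_borel_probI[OF X M])
  interpret prob_space M by fact
  have sp: "space M = topspace X" using sets_eq_imp_space_eq[OF M(2)] by simp
  have op: "openin X U \<Longrightarrow> U \<in> sets M" for U using M openin_sets_borel_of by auto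
  have cl: "closedin X U \<Longrightarrow> U \<in> sets M" for U using M closedin_sets_borel_of by auto
  have approx: "\<forall>e>0. \<exists>F U. closedin X F \<and> openin X U \<and> F \<subseteq> A \<and> A \<subseteq> U \<and> measure M (U - F) < e"
    if "A \<in> sigma_sets (topspace X) {U. openin X U}" for A
    using that
  proof induction
    case (Basic U)
    show ?case
    proof (intro allI impI)
      fix e :: real assume "0 < e"
      then obtain K where K: "compactin X K" "K \<subseteq> U" "measure M U < measure M K + e"
        using inner Basic by blast
      moreover have "closedin X K" using K X compactin_imp_closedin by blast
      ultimately have "measure M (U - K) < e"
        using finite_measure_Diff[OF op[of U] cl[of K]] Basic by auto
      then show "\<exists>F V. closedin X F \<and> openin X V \<and> F \<subseteq> U \<and> U \<subseteq> V \<and> measure M (V - F) < e"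
        using K X compactin_imp_closedin Basic by blast
    qed
  next
    case Empty
    show ?case by (intro allI impI exI[of _ "{}"]) auto
  next
    case (Compl A)
    show ?case
    proof (intro allI impI)
      fix e :: real assume "0 < e"
      then obtain F U where FU: "closedin X F" "openin X U" "F \<subseteq> A" "A \<subseteq> U" "measure M (U - F) < e"
        using Compl by meson
      have "(topspace X - F) - (topspace X - U) = U - F"
        using FU(2) openin_subset by blast
      moreover have "closedin X (topspace X - U)" "openin X (topspace X - F)"
        using closedin_diff[OF closedin_topspace FU(2)] openin_diff[OF openin_topspace FU(1)] .
      ultimately show "\<exists>F U. closedin X F \<and> openin X U \<and> F \<subseteq> topspace X - A \<and>
          topspace X - A \<subseteq> U \<and> measure M (U - F) < e"
        using FU by (intro exI[of _ "topspace X - U"] exI[of _ "topspace X - F"]) auto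
    qed
  next
    case (Union A)
    show ?case
    proof (intro allI impI)
      fix e :: real assume e: "0 < e"
      \<comment> \<open>The tolerances add up to \<open>e / 2\<close>; another \<open>e / 4\<close>
        is kept for replacing the union of all \<open>F i\<close>, which need not be closed, by a
        finite one.\<close>
      define d where "d i = e * (1/2) ^ (i + 2)" for i :: nat
      have d: "d i > 0" for i using e by (simp add: d_def)
      have "\<forall>i. \<exists>F U. closedin X F \<and> openin X U \<and> F \<subseteq> A i \<and> A i \<subseteq> U \<and> measure M (U - F) < d i"
        using Union.IH d by blast
      then obtain F U where FU: "\<And>i. closedin X (F i)" "\<And>i. openin X (U i)" "\<And>i. F i \<subseteq> A i"
        "\<And>i. A i \<subseteq> U i" "\<And>i. measure M (U i - F i) < d i"
        by metis
      have dsums: "d sums (e / 2)"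
        unfolding d_def using sums_mult[OF power_half_series, of "e/2"]
        by (simp add: field_simps)
      have FM: "F i \<in> sets M" and UM: "U i \<in> sets M" for i using FU op cl by auto
      have msum: "summable (\<lambda>i. measure M (U i - F i))"
        using FU(5) by (intro summable_comparison_test'[OF sums_summable[OF dsums], of 0])
          (simp add: less_imp_le)
      have "(\<lambda>N. measure M (\<Union>i<N. F i)) \<longlonglongrightarrow> measure M (\<Union>N. \<Union>i<N. F i)"
        using FM by (intro finite_Lim_measure_incseq) (auto simp: incseq_def dest: less_le_trans)
      moreover have "(\<Union>N. \<Union>i<N. F i) = (\<Union>i. F i)" by auto
      ultimately have "(\<lambda>N. measure M (\<Union>i<N. F i)) \<longlonglongrightarrow> measure M (\<Union>i. F i)" by simp
      then have "\<forall>\<^sub>F N in sequentially. measure M (\<Union>i. F i) - e/4 < measure M (\<Union>i<N. F i)"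
        using e by (intro order_tendstoD) auto
      then obtain N where N: "measure M (\<Union>i. F i) - e/4 < measure M (\<Union>i<N. F i)"
        by (auto simp: eventually_sequentially)
      have "measure M ((\<Union>i. U i) - (\<Union>i. F i)) \<le> measure M (\<Union>i. U i - F i)"
        using FM UM by (intro finite_measure_mono) auto
      also have "\<dots> \<le> (\<Sum>i. measure M (U i - F i))"
        using FM UM
        by (intro finite_measure_subadditive_countably msum) auto
      also have "\<dots> \<le> (\<Sum>i. d i)"
        using FU(5) by (intro suminf_le msum sums_summable[OF dsums] less_imp_le)
      also have "\<dots> = e / 2" using dsums by (simp add: sums_iff)
      finally have 1: "measure M ((\<Union>i. U i) - (\<Union>i. F i)) \<le> e / 2" .
      have "measure M ((\<Union>i. F i) - (\<Union>i<N. F i)) = measure M (\<Union>i. F i) - measure M (\<Union>i<N. F i)"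
        using FM by (intro finite_measure_Diff) auto
      then have 2: "measure M ((\<Union>i. F i) - (\<Union>i<N. F i)) < e / 4" using N by simp
      have "measure M ((\<Union>i. U i) - (\<Union>i<N. F i)) \<le>
          measure M (((\<Union>i. U i) - (\<Union>i. F i)) \<union> ((\<Union>i. F i) - (\<Union>i<N. F i)))"
        using FM UM by (intro finite_measure_mono) auto
      also have "\<dots> \<le> measure M ((\<Union>i. U i) - (\<Union>i. F i)) + measure M ((\<Union>i. F i) - (\<Union>i<N. F i))"
        using FM UM by (intro measure_Un_le) auto
      also have "\<dots> < e" using 1 2 e by simp
      finally have "measure M ((\<Union>i. U i) - (\<Union>i<N. F i)) < e" .
      moreover have "closedin X (\<Union>i<N. F i)" "openin X (\<Union>i. U i)"
        using FU(1,2) by (auto intro: closedin_Union openin_clauses(3))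
      moreover have "(\<Union>i<N. F i) \<subseteq> (\<Union>i. A i)" "(\<Union>i. A i) \<subseteq> (\<Union>i. U i)"
        using FU(3,4) by blast+
      ultimately show "\<exists>F U. closedin X F \<and> openin X U \<and> F \<subseteq> \<Union> (range A) \<and> \<Union> (range A) \<subseteq> U \<and> measure M (U - F) < e"
        by (intro exI conjI)
    qed
  qed
  fix A and e :: real assume A: "A \<in> sets M" and e: "0 < e"
  obtain F U where FU: "closedin X F" "openin X U" "F \<subseteq> A" "A \<subseteq> U" "measure M (U - F) < e / 2"
    using approx[OF A[unfolded M(2) sets_borel_of], rule_format, OF half_gt_zero[OF e]] by blast
  \<comment> \<open>The whole space is open, so the hypothesis yields a compact set of nearly full
    measure; intersecting with it makes \<open>F\<close> compact.\<close>
  obtain K where K: "compactin X K" "K \<subseteq> topspace X" "measure M (topspace X) < measure M K + e / 2"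
    using inner[of "topspace X" "e/2"] e by auto
  have KM: "K \<in> sets M" using K X cl compactin_imp_closedin by blast
  have FM: "F \<in> sets M" "U \<in> sets M" using FU cl op by auto
  have "measure M (space M - K) = 1 - measure M K" using KM prob_compl by blast
  then have Kc: "measure M (space M - K) < e / 2"
    using K(3) prob_space sp by simp
  have "measure M (A - (F \<inter> K)) \<le> measure M ((U - F) \<union> (space M - K))"
    using FM KM FU A sets.sets_into_space[OF A] by (intro finite_measure_mono) auto
  also have "\<dots> \<le> measure M (U - F) + measure M (space M - K)"
    using FM KM by (intro measure_Un_le) auto
  also have "\<dots> < e" using Kc FU by simp
  finally have "measure M A < measure M (F \<inter> K) + e"
    using finite_measure_Diff[OF A sets.Int[OF FM(1) KM] le_infI1[OF FU(3)]] by simp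
  moreover have "compactin X (F \<inter> K)" using FU K closed_Int_compactin by blast
  ultimately show "\<exists>K. compactin X K \<and> K \<subseteq> A \<and> measure M A < measure M K + e"
    using FU by blast
qed

section \<open>Product of two regular measures\<close>

text \<open>Inner regularity replaces the section by a compact subset \<open>K\<close> whose measure
  still exceeds \<open>c\<close>, and Wallace's theorem thickens \<open>K \<times> {y}\<close>
  inside the open set. This gives lower semicontinuity at \<open>y\<close>, and the sets
  \<open>K\<close> are also the material for compact approximations in the product.\<close>

lemma tube_of_large_section:
  assumes M: "regular_borel_prob X M" and U: "openin (prod_topology X Y) U" and y: "y \<in> topspace Y"
    and c: "c < measure M {x \<in> topspace X. (x, y) \<in> U}"
  obtains K V where "compactin X K" "openin Y V" "y \<in> V" "K \<times> V \<subseteq> U" "c < measure M K"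
proof -
  have "continuous_map X (prod_topology X Y) (\<lambda>x. (x, y))"
    using y by (intro continuous_map_pairedI) auto
  then have "openin X {x \<in> topspace X. (x, y) \<in> U}"
    using U openin_continuous_map_preimage by blast
  then have "{x \<in> topspace X. (x, y) \<in> U} \<in> sets M"
    using regular_borel_probD[OF M] openin_sets_borel_of by auto
  from regular_borel_prob_inner[OF M this, of "measure M {x \<in> topspace X. (x, y) \<in> U} - c"] c
  obtain K where K: "compactin X K" "K \<subseteq> {x \<in> topspace X. (x, y) \<in> U}" "c < measure M K"
    by auto
  have "K \<times> {y} \<subseteq> U" using K by auto
  then obtain V W where "openin X W" "openin Y V" "K \<subseteq> W" "{y} \<subseteq> V" "W \<times> V \<subseteq> U"
    using Wallace_theorem_prod_topology[OF K(1) _ U, of "{y}"] y by auto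
  then show thesis using that[of K V] K by blast
qed

text \<open>The product is formed as an iterated integral rather than on the product
  \<open>\<sigma>\<close>-algebra, because the latter may be smaller than the Borel \<open>\<sigma>\<close>-algebra of the product.\<close>

lemma regular_borel_prob_pair:
  assumes X: "Hausdorff_space X" and Y: "Hausdorff_space Y"
    and M: "regular_borel_prob X M" and N: "regular_borel_prob Y N"
  obtains P where "regular_borel_prob (prod_topology X Y) P"
    "\<And>g h. g \<in> borel_measurable M \<Longrightarrow> h \<in> borel_measurable N \<Longrightarrow>
       (\<integral>\<^sup>+z. g (fst z) * h (snd z) \<partial>P) = (\<integral>\<^sup>+x. g x \<partial>M) * (\<integral>\<^sup>+y. h y \<partial>N)"
proof -
  let ?XY = "prod_topology X Y"
  define B where "B = borel_of ?XY"
  \<comment> \<open>\<open>\<kappa> y\<close> is the copy of \<open>M\<close> carried by the slice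
    at height \<open>y\<close>, a measure on all Borel sets of the product.\<close>
  define \<kappa> where "\<kappa> y = distr M B (\<lambda>x. (x, y))" for y
  note MD = regular_borel_probD[OF M] and ND = regular_borel_probD[OF N]
  interpret M: prob_space M by (rule MD)
  interpret N: prob_space N by (rule ND)
  have spB: "space B = topspace X \<times> topspace Y" by (simp add: B_def)
  have XY: "Hausdorff_space ?XY" using X Y by (simp add: Hausdorff_space_prod_topology)
  have pm: "(\<lambda>x. (x, y)) \<in> M \<rightarrow>\<^sub>M B" if "y \<in> topspace Y" for y
  proof -
    have "continuous_map X ?XY (\<lambda>x. (x, y))"
      using that by (intro continuous_map_pairedI) auto
    then have "(\<lambda>x. (x, y)) \<in> borel_of X \<rightarrow>\<^sub>M B"
      unfolding B_def by (rule continuous_map_measurable_borel_of)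
    then show ?thesis using MD measurable_cong_sets by blast
  qed
  have kprob: "prob_space (\<kappa> y)" if "y \<in> topspace Y" for y
    unfolding \<kappa>_def using pm[OF that] by (rule M.prob_space_distr)
  have sets_k [simp]: "sets (\<kappa> y) = sets B" and space_k [simp]: "space (\<kappa> y) = space B" for y
    by (simp_all add: \<kappa>_def)
  have k_eq: "measure (\<kappa> y) A = measure M {x \<in> topspace X. (x, y) \<in> A}"
    if "y \<in> topspace Y" "A \<in> sets B" for y A
  proof -
    have "(\<lambda>x. (x, y)) -` A \<inter> space M = {x \<in> topspace X. (x, y) \<in> A}" using MD by auto
    then show ?thesis using that pm[of y] by (simp add: \<kappa>_def measure_distr)
  qed
  have opB: "openin ?XY U \<Longrightarrow> U \<in> sets B" for U
    by (simp add: B_def openin_sets_borel_of)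
  have lsc: "openin Y {y \<in> topspace Y. c < measure (\<kappa> y) U}" if U: "openin ?XY U" for U c
  proof (subst openin_subopen, intro ballI)
    fix y assume "y \<in> {y \<in> topspace Y. c < measure (\<kappa> y) U}"
    then have y: "y \<in> topspace Y" "c < measure M {x \<in> topspace X. (x, y) \<in> U}"
      using k_eq opB[OF U] by auto
    obtain K V where KV: "compactin X K" "openin Y V" "y \<in> V" "K \<times> V \<subseteq> U" "c < measure M K"
      using tube_of_large_section[OF M U y] by blast
    have "c < measure (\<kappa> z) U" if "z \<in> V" for z
    proof -
      have z: "z \<in> topspace Y" using that KV openin_subset by blast
      have "K \<subseteq> topspace X" using KV compactin_subset_topspace by blast
      then have "measure M K \<le> measure M ((\<lambda>x. (x, z)) -` U \<inter> space M)"
        using KV that MD(3) by (intro M.finite_measure_mono measurable_sets[OF pm[OF z] opB[OF U]]) auto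
      then show ?thesis
        using KV z pm[OF z] opB[OF U] by (simp add: \<kappa>_def measure_distr)
    qed
    then have "V \<subseteq> {y \<in> topspace Y. c < measure (\<kappa> y) U}"
      using KV openin_subset by blast
    then show "\<exists>T. openin Y T \<and> y \<in> T \<and> T \<subseteq> {y \<in> topspace Y. c < measure (\<kappa> y) U}"
      using KV by blast
  qed
  have meas_open: "(\<lambda>y. measure (\<kappa> y) U) \<in> borel_measurable N" if "openin ?XY U" for U
    using lsc[OF that] ND by (auto simp: borel_measurable_iff_greater openin_sets_borel_of)
  \<comment> \<open>Open sets are stable under intersection and generate \<open>B\<close>, so
    measurability of \<open>y \<mapsto> \<kappa> y U\<close> for open \<open>U\<close> is enough for
    \<open>\<kappa>\<close> to be a kernel.\<close>
  have k_sub: "\<kappa> \<in> N \<rightarrow>\<^sub>M subprob_algebra B"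
  proof (rule measurable_subprob_algebra_generated)
    show "sets B = sigma_sets (topspace ?XY) {U. openin ?XY U}"
      by (simp add: B_def sets_borel_of)
    show "Int_stable {U. openin ?XY U}" by (auto simp: Int_stable_def)
    show "{U. openin ?XY U} \<subseteq> Pow (topspace ?XY)" by (rule openin_Pow)
    show "subprob_space (\<kappa> y)" if "y \<in> space N" for y
      using kprob that ND prob_space_imp_subprob_space by auto
    have "(\<lambda>y. emeasure (\<kappa> y) A) \<in> borel_measurable N" if "openin ?XY A" for A
    proof -
      have "(\<lambda>y. ennreal (measure (\<kappa> y) A)) \<in> borel_measurable N"
        using meas_open[OF that] by simp
      moreover have "emeasure (\<kappa> y) A = ennreal (measure (\<kappa> y) A)" if "y \<in> space N" for y
        using kprob[of y] that ND
        by (simp add: finite_measure.emeasure_eq_measure prob_space.finite_measure)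
      ultimately show ?thesis by (simp cong: measurable_cong)
    qed
    then show "(\<lambda>y. emeasure (\<kappa> y) (topspace ?XY)) \<in> borel_measurable N"
      and "\<And>A. A \<in> {U. openin ?XY U} \<Longrightarrow> (\<lambda>y. emeasure (\<kappa> y) A) \<in> borel_measurable N"
      using openin_topspace[of ?XY] by blast+
  qed (simp add: \<kappa>_def)
  define P where "P = N \<bind> \<kappa>"
  have neN: "space N \<noteq> {}" by (rule N.not_empty)
  have setsP: "sets P = sets B" unfolding P_def using neN by (intro sets_bind) auto
  have "AE y in N. prob_space (\<kappa> y)" using kprob ND by auto
  then have probP: "prob_space P" unfolding P_def using k_sub N.prob_space_bind by blast
  interpret P: prob_space P by fact
  have measP: "measure P A = (\<integral>y. measure (\<kappa> y) A \<partial>N)" if "A \<in> sets B" for A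
    unfolding P_def by (rule N.measure_bind[OF k_sub that])
  have meas_k: "(\<lambda>y. measure (\<kappa> y) A) \<in> borel_measurable N" if "A \<in> sets B" for A
    using measurable_compose[OF k_sub measurable_measure_subprob_algebra[OF that]] .
  have k_le1: "measure (\<kappa> y) A \<le> 1" if "y \<in> topspace Y" for y A
    using kprob[OF that] prob_space.prob_le_1 by blast
  have integrable_k: "integrable N (\<lambda>y. measure (\<kappa> y) A)" if "A \<in> sets B" for A
    by (rule N.integrable_const_bound[where B=1]) (use meas_k[OF that] k_le1 ND in auto)
  have "regular_borel_prob ?XY P"
  proof (rule regular_borel_probI_open[OF XY probP])
    show "sets P = sets (borel_of ?XY)" using setsP by (simp add: B_def)
    fix U and e0 :: real assume U: "openin ?XY U" and "0 < e0"
    \<comment> \<open>The losses will be \<open>2 * e\<close> over the compact pieces and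
      \<open>e\<close> outside them, strictly less than \<open>e0\<close> in total.\<close>
    define e where "e = e0 / 4"
    have e: "0 < e" using \<open>0 < e0\<close> by (simp add: e_def)
    \<comment> \<open>Section measures are at most 1, so more than \<open>1 / e\<close> levels of
      height \<open>e\<close> cover all their values.\<close>
    obtain m :: nat where m: "1 / e < real m" using reals_Archimedean2 by blast
    have m1: "1 < real m * e" using m e by (simp add: field_simps)
    then have m0: "m > 0" by (cases m) auto
    define f where "f y = measure (\<kappa> y) U" for y
    have f0: "0 \<le> f y" for y by (simp add: f_def)
    have fm: "f \<in> borel_measurable N" unfolding f_def using meas_open[OF U] .
    \<comment> \<open>On one level set the section measure oscillates by less than \<open>e\<close>,
      which supplies the upper bound that lower semicontinuity lacks.\<close>
    define D where "D k = {y \<in> space N. real k * e \<le> f y \<and> f y < (real k + 1) * e}" for k :: nat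
    have Dm: "D k \<in> sets N" for k unfolding D_def using fm by measurable
    have "\<exists>C. compactin Y C \<and> C \<subseteq> D k \<and> measure N (D k) < measure N C + e / real m" for k
      using regular_borel_prob_inner[OF N Dm[of k], of "e / real m"] e m0 by auto
    then obtain C where C: "\<And>k. compactin Y (C k)" "\<And>k. C k \<subseteq> D k"
      "\<And>k. measure N (D k) < measure N (C k) + e / real m"
      by metis
    have Cm: "C k \<in> sets N" for k
      using C(1)[of k] ND Y compactin_sets_borel_of by metis
    \<comment> \<open>\<open>S\<close> is good if one compact subset of \<open>U\<close> captures
      every section over \<open>S\<close> up to \<open>2 * e\<close>. The property passes to finite
      unions, so on a compact set it has only to be verified locally.\<close>
    define good where "good S \<longleftrightarrow>
      (\<exists>L. compactin ?XY L \<and> L \<subseteq> U \<and> (\<forall>z\<in>S. f z \<le> measure (\<kappa> z) L + 2 * e))" for S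
    have good_Union: "good (\<Union>\<F>)" if "finite \<F>" "\<forall>S\<in>\<F>. good S" "\<Union>\<F> \<subseteq> topspace Y" for \<F>
      using that
    proof (induction \<F>)
      case empty
      then show ?case unfolding good_def by (intro exI[of _ "{}"]) auto
    next
      case (insert S \<F>)
      then obtain L1 L2 where L1: "compactin ?XY L1" "L1 \<subseteq> U" "\<forall>z\<in>S. f z \<le> measure (\<kappa> z) L1 + 2 * e"
        and L2: "compactin ?XY L2" "L2 \<subseteq> U" "\<forall>z\<in>\<Union>\<F>. f z \<le> measure (\<kappa> z) L2 + 2 * e"
        unfolding good_def by auto
      have LB: "L1 \<in> sets B" "L2 \<in> sets B"
        using L1 L2 XY compactin_sets_borel_of unfolding B_def by auto
      have "measure (\<kappa> z) L1 \<le> measure (\<kappa> z) (L1 \<union> L2)"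
        "measure (\<kappa> z) L2 \<le> measure (\<kappa> z) (L1 \<union> L2)" if "z \<in> \<Union>(insert S \<F>)" for z
        using kprob[of z] that insert.prems LB
        by (auto intro!: finite_measure.finite_measure_mono prob_space.finite_measure)
      then have "\<forall>z\<in>\<Union>(insert S \<F>). f z \<le> measure (\<kappa> z) (L1 \<union> L2) + 2 * e"
        using L1(3) L2(3) by fastforce
      moreover have "compactin ?XY (L1 \<union> L2)" using L1 L2 compactin_Un by blast
      ultimately show ?case using L1 L2 unfolding good_def by (intro exI[of _ "L1 \<union> L2"]) auto
    qed
    have goodC: "good (C k)" for k
    proof -
      let ?S = "subtopology Y (C k)"
      have CY: "C k \<subseteq> topspace Y" using C(1) compactin_subset_topspace by blast
      have cS: "compact_space ?S" using C(1) by (simp add: compactin_subspace)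
      have hS: "Hausdorff_space ?S" using Y by (simp add: Hausdorff_space_subtopology)
      \<comment> \<open>Regularity of the compact Hausdorff space \<open>C k\<close> provides,
        inside a neighbourhood \<open>V\<close> of \<open>y\<close>, a closed and hence compact
        neighbourhood \<open>Z\<close>; the tube \<open>K \<times> Z\<close> is then
        compact.\<close>
      have reg: "neighbourhood_base_of (closedin ?S) ?S"
        using compact_Hausdorff_imp_regular_space[OF cS hS] by (simp add: neighbourhood_base_of_closedin)
      have loc: "\<exists>W. openin ?S W \<and> y \<in> W \<and> good W" if y: "y \<in> C k" for y
      proof -
        have yY: "y \<in> topspace Y" using y CY by auto
        \<comment> \<open>One \<open>e\<close> is lost in choosing \<open>K\<close>, the other in
          passing from \<open>y\<close> to a point \<open>z\<close> of the same level set.\<close>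
        have "f y - e < measure M {x \<in> topspace X. (x, y) \<in> U}"
          using k_eq[OF yY opB[OF U]] e by (simp add: f_def)
        then obtain K V where KV: "compactin X K" "openin Y V" "y \<in> V" "K \<times> V \<subseteq> U" "f y - e < measure M K"
          using tube_of_large_section[OF M U yY] by blast
        have "openin ?S (C k \<inter> V)" using KV by (simp add: openin_subtopology_Int2)
        then obtain W Z where WZ: "openin ?S W" "closedin ?S Z" "y \<in> W" "W \<subseteq> Z" "Z \<subseteq> C k \<inter> V"
          using reg KV(3) y unfolding neighbourhood_base_of by (metis IntI)
        have "compactin ?S Z" using cS WZ closedin_compact_space by blast
        then have Z: "compactin Y Z" by (simp add: compactin_subtopology)
        have L: "compactin ?XY (K \<times> Z)" using KV Z by (simp add: compactin_Times)
        have "f z \<le> measure (\<kappa> z) (K \<times> Z) + 2 * e" if z: "z \<in> W" for z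
        proof -
          have zD: "z \<in> D k" "y \<in> D k" "z \<in> topspace Y"
            using subsetD[OF C(2)[of k], of z] subsetD[OF C(2)[of k], of y] z WZ y CY by auto
          have "f z < f y + e" using zD by (auto simp: D_def algebra_simps)
          moreover have "measure M K = measure (\<kappa> z) (K \<times> Z)"
          proof -
            have "{x \<in> topspace X. (x, z) \<in> K \<times> Z} = K"
              using z WZ KV compactin_subset_topspace by fastforce
            then show ?thesis
              using k_eq[OF zD(3)] compactin_sets_borel_of[OF XY L] by (simp add: B_def)
          qed
          ultimately show ?thesis using KV(5) by linarith
        qed
        moreover have "K \<times> Z \<subseteq> U" using WZ KV by blast
        ultimately show ?thesis using L WZ unfolding good_def by blast
      qed
      define \<U> where "\<U> = {W. openin ?S W \<and> good W}"
      have "C k \<subseteq> \<Union>\<U>" using loc by (auto simp: \<U>_def)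
      moreover have "\<forall>W\<in>\<U>. openin ?S W" by (simp add: \<U>_def)
      moreover have "compactin ?S (C k)" using cS CY by (simp add: compact_space_def Int_absorb1)
      ultimately obtain \<F> where \<F>: "finite \<F>" "\<F> \<subseteq> \<U>" "C k \<subseteq> \<Union>\<F>"
        unfolding compactin_def by meson
      have "\<Union>\<F> \<subseteq> topspace Y"
      proof (rule Union_least)
        fix W assume "W \<in> \<F>"
        then have "W \<subseteq> topspace ?S" using \<F>(2) openin_subset unfolding \<U>_def by blast
        then show "W \<subseteq> topspace Y" by simp
      qed
      then have "good (\<Union>\<F>)" using \<F> by (intro good_Union) (auto simp: \<U>_def)
      then show ?thesis using \<F>(3) unfolding good_def by blast
    qed
    define G where "G = (\<Union>k<m. C k)"
    have "good G" unfolding G_def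
      using goodC compactin_subset_topspace[OF C(1)] by (intro good_Union) auto
    then obtain L where L: "compactin ?XY L" "L \<subseteq> U" "\<And>z. z \<in> G \<Longrightarrow> f z \<le> measure (\<kappa> z) L + 2 * e"
      unfolding good_def by blast
    have LB: "L \<in> sets B" using L XY compactin_sets_borel_of unfolding B_def by auto
    have Gm: "G \<in> sets N" unfolding G_def using Cm by auto
    have f1: "f y \<le> 1" if "y \<in> space N" for y using k_le1 ND that by (simp add: f_def)
    have cover: "space N \<subseteq> (\<Union>k<m. D k)"
    proof
      fix y assume y: "y \<in> space N"
      define k where "k = nat \<lfloor>f y / e\<rfloor>"
      have "0 \<le> f y / e" using f0 e by simp
      then have k1: "real k \<le> f y / e" "f y / e < real k + 1" unfolding k_def by linarith+
      then have "y \<in> D k" using y e by (simp add: D_def field_simps)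
      moreover have "k < m"
      proof -
        have "f y / e \<le> 1 / e" using f1[OF y] e by (simp add: divide_right_mono)
        then show ?thesis using k1 m by linarith
      qed
      ultimately show "y \<in> (\<Union>k<m. D k)" by blast
    qed
    \<comment> \<open>Each of the \<open>m\<close> levels loses at most
      \<open>e / real m\<close>.\<close>
    have "space N - G \<subseteq> (\<Union>k<m. D k - C k)"
      using cover unfolding G_def by blast
    then have "measure N (space N - G) \<le> measure N (\<Union>k<m. D k - C k)"
      using Dm Cm by (intro N.finite_measure_mono) auto
    also have "\<dots> \<le> (\<Sum>k<m. measure N (D k - C k))"
      using Dm Cm by (intro N.finite_measure_subadditive_finite) auto
    also have "\<dots> \<le> (\<Sum>k<m. e / real m)"
    proof (rule sum_mono)
      fix k
      show "measure N (D k - C k) \<le> e / real m"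
        using N.finite_measure_Diff[OF Dm Cm C(2), of k] C(3)[of k] by simp
    qed
    also have "\<dots> = e" using m0 by simp
    finally have NG: "measure N (space N - G) \<le> e" .
    have Gi: "integrable N (indicator (space N - G) :: _ \<Rightarrow> real)"
      using Gm by (intro integrable_real_indicator) (auto simp: N.emeasure_eq_measure)
    have "measure P U = (\<integral>y. f y \<partial>N)" unfolding f_def by (rule measP[OF opB[OF U]])
    \<comment> \<open>Outside \<open>G\<close> the section measure is only known to be at most 1,
      which the indicator absorbs.\<close>
    also have "\<dots> \<le> (\<integral>y. measure (\<kappa> y) L + 2 * e + indicator (space N - G) y \<partial>N)"
    proof (rule integral_mono_AE)
      show "integrable N f" unfolding f_def by (rule integrable_k[OF opB[OF U]])
      show "integrable N (\<lambda>y. measure (\<kappa> y) L + 2 * e + indicator (space N - G) y)"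
        using integrable_k[OF LB] Gi by (intro Bochner_Integration.integrable_add) auto
      show "AE y in N. f y \<le> measure (\<kappa> y) L + 2 * e + indicator (space N - G) y"
      proof (rule AE_I2)
        fix y assume y: "y \<in> space N"
        show "f y \<le> measure (\<kappa> y) L + 2 * e + indicator (space N - G) y"
        proof (cases "y \<in> G")
          case True then show ?thesis using L(3)[of y] by simp
        next
          case False
          then have "indicator (space N - G) y = (1::real)" using y by simp
          then show ?thesis using f1[OF y] e measure_nonneg[of "\<kappa> y" L] by linarith
        qed
      qed
    qed
    also have "\<dots> = measure P L + 2 * e + measure N (space N - G)"
      using integrable_k[OF LB] Gm Gi by (simp add: measP[OF LB] N.prob_space)
    also have "\<dots> < measure P L + e0" using NG e by (simp add: e_def)
    finally show "\<exists>K. compactin ?XY K \<and> K \<subseteq> U \<and> measure P U < measure P K + e0"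
      using L by blast
  qed
  moreover have "(\<integral>\<^sup>+z. g (fst z) * h (snd z) \<partial>P) = (\<integral>\<^sup>+x. g x \<partial>M) * (\<integral>\<^sup>+y. h y \<partial>N)"
    if g: "g \<in> borel_measurable M" and h: "h \<in> borel_measurable N" for g h
  proof -
    have "fst \<in> B \<rightarrow>\<^sub>M M" "snd \<in> B \<rightarrow>\<^sub>M N"
      using continuous_map_measurable_borel_of[OF continuous_map_fst, of X Y]
        continuous_map_measurable_borel_of[OF continuous_map_snd, of X Y]
        MD ND measurable_cong_sets unfolding B_def by blast+
    then have ghB: "(\<lambda>z. g (fst z) * h (snd z)) \<in> borel_measurable B"
      using g h by (intro borel_measurable_times_ennreal) (auto intro: measurable_compose)
    have "(\<integral>\<^sup>+z. g (fst z) * h (snd z) \<partial>P) = (\<integral>\<^sup>+y. \<integral>\<^sup>+z. g (fst z) * h (snd z) \<partial>\<kappa> y \<partial>N)"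
      unfolding P_def by (rule nn_integral_bind[OF ghB k_sub])
    also have "\<dots> = (\<integral>\<^sup>+y. (\<integral>\<^sup>+x. g x \<partial>M) * h y \<partial>N)"
    proof (rule nn_integral_cong)
      fix y assume "y \<in> space N"
      then have "y \<in> topspace Y" using ND by simp
      then show "(\<integral>\<^sup>+z. g (fst z) * h (snd z) \<partial>\<kappa> y) = (\<integral>\<^sup>+x. g x \<partial>M) * h y"
        unfolding \<kappa>_def using pm ghB g by (simp add: nn_integral_distr nn_integral_multc)
    qed
    also have "\<dots> = (\<integral>\<^sup>+x. g x \<partial>M) * (\<integral>\<^sup>+y. h y \<partial>N)" using h by (rule nn_integral_cmult)
    finally show ?thesis .
  qed
  ultimately show thesis by (rule that)
qed

section \<open>Completeness of the scalar field\<close>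

text \<open>The isometry has as range the real line or the whole complex plane, and both are closed.
  Completeness serves to apply Baire's theorem to bounded operators into the field and to have
  limits of the values on Cauchy sequences of tensors.\<close>

instance real_or_complex \<subseteq> banach
proof
  fix X :: "nat \<Rightarrow> 'a" assume X: "Cauchy X"
  obtain f :: "'a \<Rightarrow> complex" where f: "\<And>x y. f (x + y) = f x + f y" "\<And>x. norm (f x) = norm x"
    "range f = \<real> \<or> range f = UNIV"
    using ex_isometry_real_or_complex by metis
  have fdiff: "f x - f y = f (x - y)" for x y
    using f(1)[of "x - y" y] by simp
  then have fdist: "dist (f x) (f y) = dist x y" for x y
    by (simp add: dist_norm f(2))
  then have "Cauchy (\<lambda>n. f (X n))" using X by (simp add: Cauchy_def)
  then obtain z where z: "(\<lambda>n. f (X n)) \<longlonglongrightarrow> z"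
    using Cauchy_convergent convergent_def by blast
  have "closed (range f)" using f(3) closed_complex_Reals by auto
  then have "z \<in> range f" by (rule closed_sequentially[OF _ _ z]) simp
  then obtain x where "z = f x" by blast
  then have "(\<lambda>n. dist (f (X n)) (f x)) \<longlonglongrightarrow> 0" using z tendsto_dist_iff[of "\<lambda>n. f (X n)" "f x" sequentially] by simp
  then have "X \<longlonglongrightarrow> x" unfolding fdist using tendsto_dist_iff[of X x sequentially] by simp
  then show "convergent X" by (auto simp: convergent_def)
qed

section \<open>Initial topologies\<close>

lemma topspace_initial_topology:
  assumes "G \<noteq> {}"
  shows "topspace (initial_topology X G) = X"
proof -
  obtain g where "g \<in> G" using assms by blast
  then have "X \<in> {{\<phi>\<in>X. g \<phi> \<in> U} | g U. g \<in> G \<and> open U}"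
    by (intro CollectI exI[of _ g] exI[of _ UNIV]) auto
  then show ?thesis
    unfolding initial_topology_def topology_generated_by_topspace by blast
qed

lemma continuous_map_initial_topology:
  assumes g: "g \<in> G"
  shows "continuous_map (initial_topology X G) euclidean g"
proof -
  have ts: "topspace (initial_topology X G) = X" using g topspace_initial_topology by blast
  have "openin (initial_topology X G) {x \<in> X. g x \<in> U}" if "open U" for U
    unfolding initial_topology_def using g that by (intro topology_generated_by_Basis) blast
  then show ?thesis by (simp add: continuous_map_def ts)
qed

lemma continuous_map_into_initial_topology:
  assumes "G \<noteq> {}" and f: "f ` topspace Z \<subseteq> X"
    and g: "\<And>g. g \<in> G \<Longrightarrow> continuous_map Z euclidean (\<lambda>z. g (f z))"
  shows "continuous_map Z (initial_topology X G) f"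
  unfolding initial_topology_def
proof (rule continuous_on_generated_topo)
  fix V assume "V \<in> {{\<phi>\<in>X. g \<phi> \<in> U} | g U. g \<in> G \<and> open U}"
  then obtain h U where V: "V = {\<phi>\<in>X. h \<phi> \<in> U}" "h \<in> G" "open U" by blast
  have "f -` V \<inter> topspace Z = {z \<in> topspace Z. h (f z) \<in> U}" using V f by auto
  then show "openin Z (f -` V \<inter> topspace Z)"
    using openin_continuous_map_preimage[OF g[OF V(2)]] V(3) by simp
next
  show "f ` topspace Z \<subseteq> \<Union> {{\<phi>\<in>X. g \<phi> \<in> U} | g U. g \<in> G \<and> open U}"
    using f topspace_initial_topology[OF \<open>G \<noteq> {}\<close>, of X]
    unfolding initial_topology_def topology_generated_by_topspace by simp
qed

lemma Hausdorff_space_initial_topology: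
  fixes G :: "('a \<Rightarrow> 'b::t2_space) set"
  assumes "G \<noteq> {}" and sep: "\<And>x y. x \<in> X \<Longrightarrow> y \<in> X \<Longrightarrow> x \<noteq> y \<Longrightarrow> \<exists>g\<in>G. g x \<noteq> g y"
  shows "Hausdorff_space (initial_topology X G)"
  unfolding Hausdorff_space_def
proof (intro allI impI)
  fix x y
  assume xy: "x \<in> topspace (initial_topology X G) \<and> y \<in> topspace (initial_topology X G) \<and> x \<noteq> y"
  then have xyX: "x \<in> X" "y \<in> X" using assms(1) by (simp_all add: topspace_initial_topology)
  obtain g where g: "g \<in> G" "g x \<noteq> g y" using sep[OF xyX] xy by blast
  obtain U V where UV: "open U" "open V" "g x \<in> U" "g y \<in> V" "U \<inter> V = {}"
    using hausdorff[OF g(2)] by blast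
  have "openin (initial_topology X G) {z \<in> X. g z \<in> W}" if "open W" for W
    unfolding initial_topology_def using g that by (intro topology_generated_by_Basis) blast
  then show "\<exists>U V. openin (initial_topology X G) U \<and> openin (initial_topology X G) V \<and>
      x \<in> U \<and> y \<in> V \<and> disjnt U V"
    using UV xyX
    by (intro exI[of _ "{z \<in> X. g z \<in> U}"] exI[of _ "{z \<in> X. g z \<in> V}"]) (auto simp: disjnt_def)
qed

section \<open>Duals and multilinear maps\<close>

lemma vector_space_field: "vector_space ((*) :: 'k::field \<Rightarrow> 'k \<Rightarrow> 'k)"
  by unfold_locales (simp_all add: algebra_simps)

text \<open>The dual is defined through linearity over the abstract field, while
  \<open>bounded_linear\<close> and the operator norm live over the reals; agreement of
  \<open>sE\<close> with real scaling on real scalars connects the two.\<close>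

lemma dual_space_iff:
  assumes "banach_over sE"
  shows "\<phi> \<in> dual_space sE \<longleftrightarrow> bounded_linear \<phi> \<and> (\<forall>c x. \<phi> (sE c x) = c * \<phi> x)"
proof -
  interpret banach_over sE by fact
  have lin: "Vector_Spaces.linear sE (*) \<phi> \<longleftrightarrow>
      (\<forall>x y. \<phi> (x + y) = \<phi> x + \<phi> y) \<and> (\<forall>c x. \<phi> (sE c x) = c * \<phi> x)"
    using vector_space_axioms vector_space_field unfolding Vector_Spaces.linear_iff by auto
  have "bounded_linear \<phi>"
    if add: "\<And>x y. \<phi> (x + y) = \<phi> x + \<phi> y" and mul: "\<And>c x. \<phi> (sE c x) = c * \<phi> x"
      and cont: "continuous_on UNIV \<phi>"
  proof -
    have sc: "\<phi> (r *\<^sub>R x) = r *\<^sub>R \<phi> x" for r x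
      using mul[of "of_real r" x] by (simp add: scale_of_real scaleR_conv_of_real)
    have z: "\<phi> 0 = 0" using sc[of 0 0] by simp
    have "isCont \<phi> 0" using cont by (simp add: continuous_on_eq_continuous_at)
    then obtain d where d: "d > 0" "\<And>x. dist x 0 < d \<Longrightarrow> dist (\<phi> x) (\<phi> 0) < 1"
      unfolding continuous_at_eps_delta by (metis zero_less_one)
    \<comment> \<open>Every nonzero \<open>x\<close> is rescaled to norm \<open>d / 2\<close>, where
      the functional is below 1 in norm.\<close>
    have "norm (\<phi> x) \<le> norm x * (2 / d)" for x
    proof (cases "x = 0")
      case False
      let ?r = "d / (2 * norm x)"
      have "norm (\<phi> (?r *\<^sub>R x)) < 1"
        using d(2)[of "?r *\<^sub>R x"] d(1) False by (simp add: z)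
      then have "?r * norm (\<phi> x) < 1" using d(1) by (simp add: sc)
      then show ?thesis using d(1) False by (simp add: field_simps)
    qed (simp add: z)
    then show ?thesis using add sc by (intro bounded_linear_intro)
  qed
  then show ?thesis
    unfolding dual_space_def mem_Collect_eq lin
    by (auto simp: linear_simps linear_continuous_on)
qed

lemma dual_ballD:
  assumes "banach_over sE" "\<phi> \<in> dual_ball sE"
  shows "bounded_linear \<phi>" "\<phi> (sE c x) = c * \<phi> x" "norm (\<phi> x) \<le> norm x"
proof -
  show b: "bounded_linear \<phi>" and "\<phi> (sE c x) = c * \<phi> x"
    using assms by (auto simp: dual_ball_def dual_space_iff)
  have "norm (\<phi> x) \<le> onorm \<phi> * norm x" using onorm[OF b] .
  also have "\<dots> \<le> 1 * norm x" using assms by (intro mult_right_mono) (auto simp: dual_ball_def)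
  finally show "norm (\<phi> x) \<le> norm x" by simp
qed

lemma zero_in_dual_ball: "banach_over sE \<Longrightarrow> (\<lambda>_. 0) \<in> dual_ball sE"
  by (simp add: dual_ball_def dual_space_iff onorm_zero)

lemma topspace_dual_ball_topology [simp]: "topspace (dual_ball_topology sE) = dual_ball sE"
  by (auto simp: dual_ball_topology_def topspace_initial_topology dual_ball_def)

lemma Hausdorff_dual_ball_topology: "Hausdorff_space (dual_ball_topology sE)"
  unfolding dual_ball_topology_def
  by (intro Hausdorff_space_subtopology Hausdorff_space_initial_topology) (auto simp: fun_eq_iff)

lemma continuous_map_dual_ball_eval: "continuous_map (dual_ball_topology sE) euclidean (\<lambda>\<phi>. \<phi> x)"
  unfolding dual_ball_topology_def
  by (intro continuous_map_from_subtopology continuous_map_initial_topology) auto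

section \<open>Multilinear maps: homogeneity, boundedness, expansion of sums\<close>

lemma multilinear_maps_iff:
  assumes "banach_over sE" "vector_space sF"
  shows "T \<in> multilinear_maps sE sF I \<longleftrightarrow> (\<forall>x. T (restrict x I) = T x) \<and>
    (\<forall>i\<in>I. \<forall>x y z. T (x(i := y + z)) = T (x(i := y)) + T (x(i := z))) \<and>
    (\<forall>i\<in>I. \<forall>x c y. T (x(i := sE c y)) = sF c (T (x(i := y))))"
proof -
  interpret banach_over sE by fact
  show ?thesis
    using vector_space_axioms assms(2) unfolding multilinear_maps_def Vector_Spaces.linear_iff by auto
qed

lemma multilinear_cong:
  assumes "T \<in> multilinear_maps sE sF I" "\<And>i. i \<in> I \<Longrightarrow> x i = y i"
  shows "T x = T y"
proof -
  have "restrict x I = restrict y I" using assms(2) by auto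
  moreover have "T (restrict x I) = T x" "T (restrict y I) = T y"
    using assms(1) by (auto simp: multilinear_maps_def)
  ultimately show ?thesis by simp
qed

text \<open>Homogeneity is stated for a subset \<open>J\<close> of the variables, both for the
  induction and because later all variables except one have to be rescaled.\<close>

lemma multilinear_scaleR:
  assumes sE: "banach_over sE" and sF: "banach_over sF" and T: "T \<in> multilinear_maps sE sF I"
    and "finite J" "J \<subseteq> I"
  shows "T (\<lambda>i. if i \<in> J then r *\<^sub>R x i else x i) = r ^ card J *\<^sub>R T x"
  using assms(4,5)
proof (induction J)
  case (insert j J)
  interpret E: banach_over sE by fact
  interpret F: banach_over sF by fact
  let ?y = "\<lambda>i. if i \<in> J then r *\<^sub>R x i else x i"
  have "(\<lambda>i. if i \<in> insert j J then r *\<^sub>R x i else x i) = ?y(j := sE (of_real r) (x j))"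
    by (auto simp: E.scale_of_real)
  then have "T (\<lambda>i. if i \<in> insert j J then r *\<^sub>R x i else x i) = sF (of_real r) (T (?y(j := x j)))"
    using T insert.prems by (simp add: multilinear_maps_iff[OF sE F.vector_space_axioms])
  also have "?y(j := x j) = ?y" using insert.hyps by auto
  finally show ?case using insert by (simp add: F.scale_of_real)
qed simp

text \<open>Continuity at the origin bounds the map on a small cube, and homogeneity of degree
  \<open>card I\<close> carries the bound to all cubes. It ensures that real suprema such as
  \<open>multilinear_norm\<close> are taken over bounded sets.\<close>

lemma cont_multilinear_bounded:
  assumes sE: "banach_over sE" and sF: "banach_over sF" and "finite I"
    and T: "T \<in> cont_multilinear_maps sE sF I"
  obtains K where "K \<ge> 0"
    "\<And>x B. B \<ge> 0 \<Longrightarrow> (\<And>i. i \<in> I \<Longrightarrow> norm (x i) \<le> B) \<Longrightarrow> norm (T x) \<le> K * B ^ card I"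
proof -
  have ml: "T \<in> multilinear_maps sE sF I"
    and cont: "continuous_map (product_topology (\<lambda>_. euclidean) I) euclidean T"
    using T by (auto simp: cont_multilinear_maps_def)
  have scale: "T (\<lambda>i. r *\<^sub>R x i) = r ^ card I *\<^sub>R T x" for r x
  proof -
    have "T (\<lambda>i. r *\<^sub>R x i) = T (\<lambda>i. if i \<in> I then r *\<^sub>R x i else x i)"
      using ml by (rule multilinear_cong) simp
    then show ?thesis using multilinear_scaleR[OF sE sF ml \<open>finite I\<close> order_refl] by simp
  qed
  define z where "z = T (\<lambda>_. 0)"
  let ?W = "{x \<in> topspace (product_topology (\<lambda>_. euclidean) I). T x \<in> ball z 1}"
  have "openin (product_topology (\<lambda>_. euclidean) I) ?W"
    using cont by (rule openin_continuous_map_preimage) simp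
  moreover have "restrict (\<lambda>_. 0) I \<in> ?W"
    using ml by (auto simp: z_def multilinear_maps_def)
  ultimately obtain U where U: "\<And>i. i \<in> I \<Longrightarrow> open (U i)" "restrict (\<lambda>_. 0) I \<in> PiE I U" "PiE I U \<subseteq> ?W"
    unfolding openin_product_topology_alt by (metis (no_types, lifting) open_openin)
  have "\<exists>d>0. ball 0 d \<subseteq> U i" if "i \<in> I" for i
  proof -
    have "0 \<in> U i" using U(2) that by (auto simp: PiE_iff)
    then show ?thesis using U(1)[OF that] open_contains_ball by blast
  qed
  then obtain d where d: "\<And>i. i \<in> I \<Longrightarrow> 0 < d i" "\<And>i. i \<in> I \<Longrightarrow> ball 0 (d i) \<subseteq> U i" by metis
  \<comment> \<open>The 1 keeps the minimum meaningful for empty \<open>I\<close>; halving makes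
    closed balls of radius \<open>\<delta>\<close> fit into the open ones.\<close>
  define \<delta> where "\<delta> = Min (insert 1 (d ` I)) / 2"
  have "0 < Min (insert 1 (d ` I))" using \<open>finite I\<close> d(1) by (subst Min_gr_iff) auto
  then have \<delta>0: "0 < \<delta>" by (simp add: \<delta>_def)
  have \<delta>d: "\<delta> < d i" if "i \<in> I" for i
  proof -
    have "Min (insert 1 (d ` I)) \<le> d i" using \<open>finite I\<close> that by (intro Min_le) auto
    then show ?thesis using \<delta>0 unfolding \<delta>_def by linarith
  qed
  \<comment> \<open>The value at the origin is kept because for empty \<open>I\<close> the map is a
    constant, possibly nonzero.\<close>
  define K0 where "K0 = norm z + 1"
  have small: "norm (T x) \<le> K0" if "\<And>i. i \<in> I \<Longrightarrow> norm (x i) \<le> \<delta>" for x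
  proof -
    have "restrict x I \<in> PiE I U"
    proof (rule restrict_PiE_iff[THEN iffD2], intro ballI)
      fix i assume i: "i \<in> I"
      then have "x i \<in> ball 0 (d i)" using that[OF i] \<delta>d[OF i] by simp
      then show "x i \<in> U i" using d(2)[OF i] by blast
    qed
    then have "T (restrict x I) \<in> ball z 1" using U(3) by blast
    then have "dist z (T x) < 1" using ml by (simp add: multilinear_maps_def)
    then show ?thesis unfolding K0_def using norm_triangle_sub[of "T x" z]
      by (simp add: dist_norm norm_minus_commute)
  qed
  define K where "K = K0 * (1 / \<delta>) ^ card I"
  have K0: "0 \<le> K0" by (simp add: K0_def)
  show thesis
  proof (rule that[of K])
    show "0 \<le> K" using K0 \<delta>0 by (simp add: K_def)
    fix x :: "nat \<Rightarrow> 'b" and B :: real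
    assume B: "0 \<le> B" and x: "\<And>i. i \<in> I \<Longrightarrow> norm (x i) \<le> B"
    show "norm (T x) \<le> K * B ^ card I"
    proof (cases "B = 0")
      case True
      have "T x = T (\<lambda>i. 0 *\<^sub>R x i)" using ml by (rule multilinear_cong) (use x True in auto)
      also have "\<dots> = 0 ^ card I *\<^sub>R T x" by (rule scale)
      finally have "T x = 0 ^ card I *\<^sub>R T x" .
      moreover have "norm (T x) \<le> K0" by (rule small) (use x True \<delta>0 in force)
      ultimately show ?thesis
        by (cases "card I = 0") (simp_all add: K_def True power_0_left del: card_eq_0_iff)
    next
      case False
      let ?y = "\<lambda>i. (\<delta> / B) *\<^sub>R x i"
      have "norm (T ?y) \<le> K0"
      proof (rule small)
        fix i assume "i \<in> I"
        then show "norm (?y i) \<le> \<delta>" using x[of i] \<delta>0 B False by (simp add: field_simps)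
      qed
      then have "(\<delta> / B) ^ card I * norm (T x) \<le> K0" using \<delta>0 B by (simp add: scale)
      then show ?thesis using \<delta>0 B False by (simp add: K_def field_simps)
    qed
  qed
qed

text \<open>\<open>S\<close> records the variables that receive \<open>x\<close>. Splitting at a new
  variable \<open>j\<close> either keeps \<open>a j\<close> or replaces it by \<open>x j\<close>;
  the second choice is the same expansion with another base point, which is why the induction
  generalizes \<open>a\<close>.\<close>

lemma multilinear_add_expand:
  assumes sE: "banach_over sE" and sF: "vector_space sF" and T: "T \<in> multilinear_maps sE sF I"
    and "finite J" "J \<subseteq> I"
  shows "T (\<lambda>i. if i \<in> J then a i + x i else a i) = (\<Sum>S\<in>Pow J. T (\<lambda>i. if i \<in> S then x i else a i))"
  using assms(4,5)
proof (induction J arbitrary: a)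
  case (insert j J)
  let ?y = "\<lambda>a i. if i \<in> J then a i + x i else a i"
  let ?a = "a(j := x j)"
  have "T (\<lambda>i. if i \<in> insert j J then a i + x i else a i) = T ((?y a)(j := a j + x j))"
    using insert.hyps by (intro arg_cong[of _ _ T]) auto
  also have "\<dots> = T ((?y a)(j := a j)) + T ((?y a)(j := x j))"
    using T insert.prems by (simp add: multilinear_maps_iff[OF sE sF])
  also have "(?y a)(j := a j) = ?y a" using insert.hyps by auto
  also have "(?y a)(j := x j) = ?y ?a" using insert.hyps by auto
  also have "T (?y a) + T (?y ?a) =
      (\<Sum>S\<in>Pow J. T (\<lambda>i. if i \<in> S then x i else a i)) + (\<Sum>S\<in>Pow J. T (\<lambda>i. if i \<in> S then x i else ?a i))"
    using insert by simp
  also have "(\<Sum>S\<in>Pow J. T (\<lambda>i. if i \<in> S then x i else ?a i)) =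
      (\<Sum>S\<in>insert j ` Pow J. T (\<lambda>i. if i \<in> S then x i else a i))"
  proof (subst sum.reindex)
    show "inj_on (insert j) (Pow J)" using insert.hyps by (auto simp: inj_on_def)
    have "(\<lambda>i. if i \<in> S then x i else ?a i) = (\<lambda>i. if i \<in> insert j S then x i else a i)" for S
      by auto
    then show "(\<Sum>S\<in>Pow J. T (\<lambda>i. if i \<in> S then x i else ?a i)) =
      sum ((\<lambda>S. T (\<lambda>i. if i \<in> S then x i else a i)) \<circ> insert j) (Pow J)" by simp
  qed
  also have "(\<Sum>S\<in>Pow J. T (\<lambda>i. if i \<in> S then x i else a i)) +
      (\<Sum>S\<in>insert j ` Pow J. T (\<lambda>i. if i \<in> S then x i else a i)) =
      (\<Sum>S\<in>Pow (insert j J). T (\<lambda>i. if i \<in> S then x i else a i))"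
    unfolding Pow_insert using insert.hyps by (intro sum.union_disjoint[symmetric]) auto
  finally show ?case .
qed simp

section \<open>Uniform boundedness for weakly summable sequences\<close>

text \<open>From \<open>a + b \<le> 2 * max a b\<close>, hence for every positive exponent. It
  stands in for Minkowski's inequality, which fails for exponents below 1.\<close>

lemma powr_add_le:
  fixes a b p :: real
  assumes "0 \<le> a" "0 \<le> b" "0 < p"
  shows "(a + b) powr p \<le> 2 powr p * (a powr p + b powr p)"
proof -
  have "(a + b) powr p \<le> (2 * max a b) powr p" using assms by (intro powr_mono2) auto
  also have "\<dots> = 2 powr p * max a b powr p" using assms by (simp add: powr_mult)
  also have "\<dots> \<le> 2 powr p * (a powr p + b powr p)" by (intro mult_left_mono) (auto simp: max_def)
  finally show ?thesis .
qed

text \<open>The closed sets on which all partial sums are at most \<open>M\<close> exhaust the dual,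
  so one of them contains a ball of the dual. Each functional in the unit ball is a scaled
  difference of two points of that ball.\<close>

lemma weak_lp_uniform_bound:
  fixes sE :: "'k::real_or_complex \<Rightarrow> 'e::banach \<Rightarrow> 'e"
  assumes sE: "banach_over sE" and p: "0 < p" and x: "x \<in> weak_lp sE (ereal p)"
  obtains B where "\<And>\<phi> N. \<phi> \<in> dual_ball sE \<Longrightarrow> (\<Sum>m<N. norm (\<phi> (x m)) powr p) \<le> B"
proof -
  interpret banach_over sE by fact
  \<comment> \<open>Elements of the operator type are only real-linear; the dual is a closed subset
    of it, hence completely metrizable.\<close>
  define S :: "('e \<Rightarrow>\<^sub>L 'k) set" where "S = {f. blinfun_apply f \<in> dual_space sE}"
  have S_eq: "S = (\<Inter>c y. {f. blinfun_apply f (sE c y) = c * blinfun_apply f y})"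
    by (auto simp: S_def dual_space_iff[OF sE] blinfun.bounded_linear_right)
  have S: "closed S" unfolding S_eq
    by (intro closed_INT ballI closed_Collect_eq continuous_intros)
  let ?q = "\<lambda>N (f :: 'e \<Rightarrow>\<^sub>L 'k). \<Sum>m<N. norm (f (x m)) powr p"
  define G where "G M = S \<inter> (\<Inter>N. {f. ?q N f \<le> real M})" for M :: nat
  have "continuous_on UNIV (\<lambda>f :: 'e \<Rightarrow>\<^sub>L 'k. norm (f y) powr p)" for y
    using p by (intro continuous_on_powr' continuous_intros) auto
  then have Gc: "closed (G M)" for M unfolding G_def
    by (intro closed_Int S closed_INT ballI closed_Collect_le continuous_on_sum continuous_on_const) auto
  have SG: "S \<subseteq> (\<Union>M. G M)"
  proof
    fix f assume f: "f \<in> S"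
    then have "summable (\<lambda>m. norm (f (x m)) powr p)"
      using x by (simp add: weak_lp_def lp_def S_def)
    then have "?q N f \<le> (\<Sum>m. norm (f (x m)) powr p)" for N
      by (intro sum_le_suminf) auto
    moreover obtain M :: nat where "(\<Sum>m. norm (f (x m)) powr p) \<le> real M"
      using real_arch_simple by blast
    ultimately have "f \<in> G M" using f unfolding G_def by (auto intro: order_trans)
    then show "f \<in> (\<Union>M. G M)" by blast
  qed
  have S0: "0 \<in> S" by (simp add: S_eq)
  have "\<exists>M. top_of_set S interior_of G M \<noteq> {}"
  proof (rule ccontr)
    assume "\<not> ?thesis"
    moreover have "closedin (top_of_set S) (G M)" for M
      using Gc[of M] by (rule closed_subset[rotated]) (auto simp: G_def)
    moreover have "completely_metrizable_space (top_of_set S)"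
      by (rule completely_metrizable_space_closedin[OF completely_metrizable_space_euclidean
            S[unfolded closed_closedin]])
    ultimately have "top_of_set S interior_of \<Union>(range G) = {}"
      by (intro Baire_category_alt) blast+
    moreover have "\<Union>(range G) = topspace (top_of_set S)" using SG by (auto simp: G_def)
    ultimately show False using S0 interior_of_topspace[of "top_of_set S"] by simp
  qed
  then obtain M f0 where "f0 \<in> top_of_set S interior_of G M" by blast
  then obtain U where U: "openin (top_of_set S) U" "f0 \<in> U" "U \<subseteq> G M"
    unfolding interior_of_def by blast
  obtain r0 where r0: "0 < r0" "ball f0 r0 \<inter> S \<subseteq> U"
    using U(1,2) by (auto simp: openin_contains_ball)
  \<comment> \<open>Halving the radius keeps \<open>f0 + r *\<^sub>R g\<close> in the open ball even
    when \<open>g\<close> has norm 1.\<close>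
  define r where "r = r0 / 2"
  have r: "0 < r" "r < r0" using r0 by (auto simp: r_def)
  have f0: "f0 \<in> S" "f0 \<in> G M" using U by (auto simp: G_def)
  \<comment> \<open>Two sums bounded by \<open>M\<close>, at \<open>f0 + r *\<^sub>R g\<close> and
    at \<open>f0\<close>, enter with the factor \<open>2 powr p\<close>; undoing the scaling divides
    by \<open>r powr p\<close>.\<close>
  show thesis
  proof (rule that[of "2 powr p * (2 * real M) / r powr p"])
    fix \<phi> N assume \<phi>: "\<phi> \<in> dual_ball sE"
    note \<phi>D = dual_ballD[OF sE \<phi>]
    define g where "g = Blinfun \<phi>"
    have g: "blinfun_apply g = \<phi>" using \<phi>D(1) by (simp add: g_def bounded_linear_Blinfun_apply)
    have "norm g \<le> 1" using \<phi> g by (simp add: norm_blinfun.rep_eq dual_ball_def)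
    then have "dist f0 (f0 + r *\<^sub>R g) < r0"
      using r mult_left_mono[of "norm g" 1 r] le_less_trans[of "r * norm g" r r0]
      by (simp add: dist_norm)
    moreover have "f0 + r *\<^sub>R g \<in> S"
      unfolding S_eq using f0(1) \<phi>D(2) unfolding S_eq
      by (auto simp: blinfun.add_left blinfun.scaleR_left g algebra_simps)
    ultimately have fr: "f0 + r *\<^sub>R g \<in> G M"
      using subsetD[OF r0(2), of "f0 + r *\<^sub>R g"] U(3) by auto
    have "norm (r *\<^sub>R \<phi> (x m)) powr p \<le>
        2 powr p * (norm ((f0 + r *\<^sub>R g) (x m)) powr p + norm (f0 (x m)) powr p)" for m
    proof -
      have "r *\<^sub>R \<phi> (x m) = (f0 + r *\<^sub>R g) (x m) - f0 (x m)"
        by (simp add: blinfun.add_left blinfun.scaleR_left g)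
      then have "norm (r *\<^sub>R \<phi> (x m)) \<le> norm ((f0 + r *\<^sub>R g) (x m)) + norm (f0 (x m))"
        by (metis norm_triangle_ineq4)
      then have "norm (r *\<^sub>R \<phi> (x m)) powr p \<le> (norm ((f0 + r *\<^sub>R g) (x m)) + norm (f0 (x m))) powr p"
        using p by (intro powr_mono2) auto
      also have "\<dots> \<le> 2 powr p * (norm ((f0 + r *\<^sub>R g) (x m)) powr p + norm (f0 (x m)) powr p)"
        using p by (intro powr_add_le) auto
      finally show ?thesis .
    qed
    then have "(\<Sum>m<N. norm (r *\<^sub>R \<phi> (x m)) powr p) \<le> 2 powr p * (?q N (f0 + r *\<^sub>R g) + ?q N f0)"
      by (simp only: sum_distrib_left sum.distrib[symmetric] sum_mono)
    also have "\<dots> \<le> 2 powr p * (real M + real M)"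
      using fr f0(2) unfolding G_def by (intro mult_left_mono add_mono) auto
    also have "(\<Sum>m<N. norm (r *\<^sub>R \<phi> (x m)) powr p) = r powr p * (\<Sum>m<N. norm (\<phi> (x m)) powr p)"
      using r by (simp add: powr_mult sum_distrib_left)
    finally show "(\<Sum>m<N. norm (\<phi> (x m)) powr p) \<le> 2 powr p * (2 * real M) / r powr p"
      using r by (simp add: field_simps)
  qed
qed

text \<open>The uniform bound makes the real \<open>SUP\<close> in \<open>weak_lp_norm\<close> a
  supremum over a bounded set, hence an upper bound; the zero functional shows that it is
  nonnegative.\<close>

lemma weak_lp_norm_nonneg_bound:
  fixes sE :: "'k::real_or_complex \<Rightarrow> 'e::banach \<Rightarrow> 'e"
  assumes sE: "banach_over sE" and p: "0 < p" and x: "x \<in> weak_lp sE (ereal p)"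
  shows "0 \<le> weak_lp_norm sE p x"
    and "\<phi> \<in> dual_ball sE \<Longrightarrow> (\<Sum>m<N. norm (\<phi> (x m)) powr p) \<le> weak_lp_norm sE p x powr p"
proof -
  obtain B where B: "\<And>\<phi> N. \<phi> \<in> dual_ball sE \<Longrightarrow> (\<Sum>m<N. norm (\<phi> (x m)) powr p) \<le> B"
    using weak_lp_uniform_bound[OF assms] by blast
  have summ: "summable (\<lambda>m. norm (\<phi> (x m)) powr p)" if "\<phi> \<in> dual_ball sE" for \<phi>
    using that x by (simp add: weak_lp_def lp_def dual_ball_def)
  have le: "lp_norm norm p (\<lambda>m. \<phi> (x m)) \<le> B powr (1 / p)" if "\<phi> \<in> dual_ball sE" for \<phi>
    unfolding lp_norm_def
    using p B[OF that] summ[OF that] by (intro powr_mono2 suminf_le_const suminf_nonneg) auto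
  have bdd: "bdd_above ((\<lambda>\<phi>. lp_norm norm p (\<lambda>m. \<phi> (x m))) ` dual_ball sE)"
    using le by (intro bdd_aboveI2)
  have upper: "lp_norm norm p (\<lambda>m. \<phi> (x m)) \<le> weak_lp_norm sE p x" if "\<phi> \<in> dual_ball sE" for \<phi>
    unfolding weak_lp_norm_def by (rule cSUP_upper[OF that bdd])
  have "0 \<le> lp_norm norm p (\<lambda>m. (\<lambda>_. 0 :: 'k) (x m))" by (simp add: lp_norm_def)
  also have "\<dots> \<le> weak_lp_norm sE p x" by (rule upper[OF zero_in_dual_ball[OF sE]])
  finally show "0 \<le> weak_lp_norm sE p x" .
  assume \<phi>: "\<phi> \<in> dual_ball sE"
  have "(\<Sum>m<N. norm (\<phi> (x m)) powr p) \<le> (\<Sum>m. norm (\<phi> (x m)) powr p)"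
    using summ[OF \<phi>] by (intro sum_le_suminf) auto
  also have "\<dots> = lp_norm norm p (\<lambda>m. \<phi> (x m)) powr p"
    using p summ[OF \<phi>] by (simp add: lp_norm_def powr_powr suminf_nonneg)
  also have "\<dots> \<le> weak_lp_norm sE p x powr p"
    using p upper[OF \<phi>] by (intro powr_mono2) (auto simp: lp_norm_def)
  finally show "(\<Sum>m<N. norm (\<phi> (x m)) powr p) \<le> weak_lp_norm sE p x powr p" .
qed

section \<open>Finite products of regular measures\<close>

text \<open>Base case of the product construction: a product without factors is a single point, and
  all its subsets are finite, hence compact.\<close>

lemma regular_borel_prob_point:
  assumes x: "topspace X = {x}"
  shows "regular_borel_prob X (return (borel_of X) x)"
proof (rule regular_borel_probI)
  show "Hausdorff_space X" using x by (simp add: Hausdorff_space_def)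
  show "prob_space (return (borel_of X) x)" using x by (intro prob_space_return) simp
  fix A and e :: real assume A: "A \<in> sets (return (borel_of X) x)" and "0 < e"
  then have sub: "A \<subseteq> {x}" using sets.sets_into_space[of A "borel_of X"] x by simp
  then have "finite A" by (rule finite_subset) simp
  then have "compactin X A" using sub x by (simp add: finite_imp_compactin)
  then show "\<exists>K. compactin X K \<and> K \<subseteq> A \<and>
      measure (return (borel_of X) x) A < measure (return (borel_of X) x) K + e"
    using \<open>0 < e\<close> by (intro exI[of _ A]) simp
qed simp

lemma regular_borel_prob_measurable_component:
  assumes "regular_borel_prob (product_topology X I) P" "i \<in> I"
    "regular_borel_prob (X i) M" "g \<in> borel_measurable M"
  shows "(\<lambda>z. g (z i)) \<in> borel_measurable P"
proof -
  have "continuous_map (product_topology X I) (X i) (\<lambda>z. z i)"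
    using assms(2) by (rule continuous_map_product_projection)
  then have "(\<lambda>z. z i) \<in> borel_of (product_topology X I) \<rightarrow>\<^sub>M borel_of (X i)"
    by (rule continuous_map_measurable_borel_of)
  then have "(\<lambda>z. z i) \<in> P \<rightarrow>\<^sub>M M"
    using regular_borel_probD(2)[OF assms(1)] regular_borel_probD(2)[OF assms(3)]
      measurable_cong_sets by blast
  then show ?thesis by (rule measurable_compose) (rule assms(4))
qed

text \<open>A new factor is adjoined by the continuous map
  \<open>(z, y) \<mapsto> z(n := y)\<close>, so regularity passes to the image measure. Stating the
  product formula for nonnegative integrals avoids carrying integrability through the
  induction.\<close>

lemma regular_borel_prob_product:
  fixes X :: "nat \<Rightarrow> 'a topology" and \<mu> :: "nat \<Rightarrow> 'a measure"
  assumes "\<And>j. j < n \<Longrightarrow> Hausdorff_space (X j)" "\<And>j. j < n \<Longrightarrow> regular_borel_prob (X j) (\<mu> j)"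
  shows "\<exists>P. regular_borel_prob (product_topology X {..<n}) P \<and>
    (\<forall>g. (\<forall>j<n. g j \<in> borel_measurable (\<mu> j)) \<longrightarrow>
      (\<integral>\<^sup>+z. (\<Prod>j<n. g j (z j)) \<partial>P) = (\<Prod>j<n. \<integral>\<^sup>+y. g j y \<partial>\<mu> j))"
  using assms
proof (induction n)
  case 0
  \<comment> \<open>The empty product has the everywhere undefined function as its only
    point.\<close>
  let ?P = "return (borel_of (product_topology X {..<0})) (\<lambda>_. undefined)"
  have "regular_borel_prob (product_topology X {..<0}) ?P"
    by (rule regular_borel_prob_point) simp
  moreover from this have "emeasure ?P (space ?P) = 1"
    by (intro prob_space.emeasure_space_1 regular_borel_probD(1))
  ultimately show ?case
    by (intro exI[of _ ?P]) (simp only: lessThan_0 prod.empty nn_integral_const mult_1_left simp_thms)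
next
  case (Suc n)
  let ?X = "product_topology X {..<n}" and ?X' = "product_topology X {..<Suc n}"
  obtain Q where Q: "regular_borel_prob ?X Q"
    "\<And>g. (\<forall>j<n. g j \<in> borel_measurable (\<mu> j)) \<Longrightarrow>
      (\<integral>\<^sup>+z. (\<Prod>j<n. g j (z j)) \<partial>Q) = (\<Prod>j<n. \<integral>\<^sup>+y. g j y \<partial>\<mu> j)"
    using Suc.IH[OF Suc.prems(1)[OF less_SucI] Suc.prems(2)[OF less_SucI]] by blast
  have H: "Hausdorff_space ?X" "Hausdorff_space (X n)" "Hausdorff_space ?X'"
    using Suc.prems(1) by (auto simp: Hausdorff_space_product_topology)
  have \<mu>n: "regular_borel_prob (X n) (\<mu> n)" using Suc.prems(2) by simp
  obtain R where R: "regular_borel_prob (prod_topology ?X (X n)) R"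
    "\<And>g h. g \<in> borel_measurable Q \<Longrightarrow> h \<in> borel_measurable (\<mu> n) \<Longrightarrow>
       (\<integral>\<^sup>+z. g (fst z) * h (snd z) \<partial>R) = (\<integral>\<^sup>+x. g x \<partial>Q) * (\<integral>\<^sup>+y. h y \<partial>\<mu> n)"
    using regular_borel_prob_pair[OF H(1,2) Q(1) \<mu>n] by blast
  define f where "f z = (fst z)(n := snd z)" for z :: "(nat \<Rightarrow> 'a) \<times> 'a"
  have f: "continuous_map (prod_topology ?X (X n)) ?X' f"
    unfolding continuous_map_componentwise
  proof (intro conjI ballI)
    show "f ` topspace (prod_topology ?X (X n)) \<subseteq> extensional {..<Suc n}"
      by (auto simp: f_def PiE_iff extensional_def)
    fix k assume k: "k \<in> {..<Suc n}"
    show "continuous_map (prod_topology ?X (X n)) (X k) (\<lambda>z. f z k)"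
    proof (cases "k = n")
      case True
      then show ?thesis by (simp add: f_def continuous_map_snd)
    next
      case False
      then have "continuous_map ?X (X k) (\<lambda>z. z k)"
        using k by (intro continuous_map_product_projection) auto
      then have "continuous_map (prod_topology ?X (X n)) (X k) ((\<lambda>z. z k) \<circ> fst)"
        by (rule continuous_map_compose[OF continuous_map_fst])
      then show ?thesis using False by (simp add: f_def comp_def)
    qed
  qed
  define P where "P = distr R (borel_of ?X') f"
  have P: "regular_borel_prob ?X' P"
    unfolding P_def by (rule regular_borel_prob_distr[OF R(1) f H(3)])
  have fm: "f \<in> R \<rightarrow>\<^sub>M borel_of ?X'"
    using continuous_map_measurable_borel_of[OF f] regular_borel_probD(2)[OF R(1)] measurable_cong_sets
    by blast
  have "(\<integral>\<^sup>+z. (\<Prod>j<Suc n. g j (z j)) \<partial>P) = (\<Prod>j<Suc n. \<integral>\<^sup>+y. g j y \<partial>\<mu> j)"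
    if g: "\<forall>j<Suc n. g j \<in> borel_measurable (\<mu> j)" for g
  proof -
    have "(\<lambda>z. g j (z j)) \<in> borel_measurable P" if "j < Suc n" for j
      by (rule regular_borel_prob_measurable_component[OF P _ Suc.prems(2)[OF that]]) (use g that in auto)
    then have gP: "(\<lambda>z. \<Prod>j<Suc n. g j (z j)) \<in> borel_measurable P"
      by (intro borel_measurable_prod_ennreal) auto
    have "(\<lambda>z. g j (z j)) \<in> borel_measurable Q" if "j < n" for j
      by (rule regular_borel_prob_measurable_component[OF Q(1) _ Suc.prems(2)]) (use g that in auto)
    then have gQ: "(\<lambda>z. \<Prod>j<n. g j (z j)) \<in> borel_measurable Q"
      by (intro borel_measurable_prod_ennreal) auto
    have "(\<integral>\<^sup>+z. (\<Prod>j<Suc n. g j (z j)) \<partial>P) = (\<integral>\<^sup>+z. (\<Prod>j<Suc n. g j (f z j)) \<partial>R)"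
      using fm gP by (simp add: P_def nn_integral_distr)
    also have "\<dots> = (\<integral>\<^sup>+z. (\<Prod>j<n. g j (fst z j)) * g n (snd z) \<partial>R)"
      by (simp add: f_def)
    also have "\<dots> = (\<integral>\<^sup>+z. (\<Prod>j<n. g j (z j)) \<partial>Q) * (\<integral>\<^sup>+y. g n y \<partial>\<mu> n)"
      using R(2)[OF gQ] g by simp
    also have "\<dots> = (\<Prod>j<Suc n. \<integral>\<^sup>+y. g j y \<partial>\<mu> j)" using Q(2)[of g] g by simp
    finally show ?thesis .
  qed
  then show ?case using P by blast
qed

section \<open>Hoelder's inequality\<close>

text \<open>Each factor is divided by its norm with exponent \<open>card J\<close>, and the
  inequality of arithmetic and geometric means is integrated. Equal exponents suffice: they are what
  turns \<open>p\<close> into \<open>n * p\<close> for \<open>n\<close> factors.\<close>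

lemma Hoelder_prod_powr:
  fixes f :: "'i \<Rightarrow> 'a \<Rightarrow> real"
  assumes J: "finite J" "J \<noteq> {}"
    and f0: "\<And>j z. j \<in> J \<Longrightarrow> 0 \<le> f j z"
    and fm: "\<And>j. j \<in> J \<Longrightarrow> f j \<in> borel_measurable M"
    and int: "\<And>j. j \<in> J \<Longrightarrow> integrable M (\<lambda>z. f j z powr real (card J))"
  shows "(\<integral>z. (\<Prod>j\<in>J. f j z) \<partial>M) \<le> (\<Prod>j\<in>J. (\<integral>z. f j z powr real (card J) \<partial>M) powr (1 / real (card J)))"
proof -
  define n where "n = real (card J)"
  have n: "n > 0" using J by (simp add: n_def card_gt_0_iff)
  define I where "I j = (\<integral>z. f j z powr n \<partial>M)" for j
  have I0: "0 \<le> I j" for j by (simp add: I_def)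
  show ?thesis
  proof (cases "\<exists>j\<in>J. I j = 0")
    \<comment> \<open>A factor of norm 0 cannot be normalized, but it vanishes almost everywhere,
      and so does the product.\<close>
    case True
    then obtain j where j: "j \<in> J" "I j = 0" by blast
    then have "AE z in M. f j z powr n = 0"
      using int[OF j(1)] integral_nonneg_eq_0_iff_AE[of M "\<lambda>z. f j z powr n"] by (simp add: I_def n_def)
    then have "AE z in M. (\<Prod>j\<in>J. f j z) = 0"
      by eventually_elim (use j J in \<open>auto intro: prod_zero\<close>)
    then have "(\<integral>z. (\<Prod>j\<in>J. f j z) \<partial>M) = 0" by (rule integral_eq_zero_AE)
    then show ?thesis by (simp add: prod_nonneg)
  next
    case False
    then have Ipos: "I j > 0" if "j \<in> J" for j using that I0[of j] by (metis less_eq_real_def)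
    define c where "c j = I j powr (1 / n)" for j
    have c: "c j > 0" "c j powr n = I j" if "j \<in> J" for j
      using Ipos[OF that] n by (simp_all add: c_def powr_powr)
    have amgm: "(\<Prod>j\<in>J. f j z / c j) \<le> (\<Sum>j\<in>J. f j z powr n / I j / n)" for z
    proof -
      have "(\<Prod>j\<in>J. f j z / c j) = (\<Prod>j\<in>J. (f j z powr n / I j) powr (1 / n))"
      proof (rule prod.cong[OF refl])
        fix j assume j: "j \<in> J"
        have "f j z powr n / I j = (f j z / c j) powr n"
          using f0[OF j] c[OF j] by (simp add: powr_divide)
        then show "f j z / c j = (f j z powr n / I j) powr (1 / n)"
          using f0[OF j, of z] c[OF j] n by (simp add: powr_powr)
      qed
      also have "\<dots> = (\<Prod>j\<in>J. f j z powr n / I j) powr (1 / real (card J))"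
        by (simp add: prod_powr_distrib n_def)
      also have "\<dots> \<le> (\<Sum>j\<in>J. f j z powr n / I j / real (card J))"
        using I0 by (intro arith_geom_mean J) auto
      finally show ?thesis by (simp add: n_def)
    qed
    have rint: "integrable M (\<lambda>z. \<Sum>j\<in>J. f j z powr n / I j / n)"
      using int by (intro Bochner_Integration.integrable_sum) (simp add: n_def)
    have lint: "integrable M (\<lambda>z. \<Prod>j\<in>J. f j z / c j)"
    proof (rule Bochner_Integration.integrable_bound[OF rint])
      show "(\<lambda>z. \<Prod>j\<in>J. f j z / c j) \<in> borel_measurable M" using fm by measurable
      have "0 \<le> (\<Prod>j\<in>J. f j z / c j)" for z
        using f0 c by (intro prod_nonneg) (simp add: less_imp_le)
      then show "AE z in M. norm (\<Prod>j\<in>J. f j z / c j) \<le> norm (\<Sum>j\<in>J. f j z powr n / I j / n)"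
        using amgm by (auto intro!: AE_I2 order_trans[OF _ abs_ge_self])
    qed
    have "(\<integral>z. (\<Prod>j\<in>J. f j z / c j) \<partial>M) \<le> (\<integral>z. (\<Sum>j\<in>J. f j z powr n / I j / n) \<partial>M)"
      using amgm by (intro integral_mono lint rint)
    also have "\<dots> = (\<Sum>j\<in>J. (\<integral>z. f j z powr n / I j / n \<partial>M))"
      using int by (intro Bochner_Integration.integral_sum) (simp add: n_def)
    also have "\<dots> = (\<Sum>j\<in>J. 1 / n)"
      using Ipos by (intro sum.cong) (simp_all add: I_def[symmetric] less_imp_neq[symmetric])
    also have "\<dots> = 1" using n by (simp add: n_def)
    finally have "(\<integral>z. (\<Prod>j\<in>J. f j z) / (\<Prod>j\<in>J. c j) \<partial>M) \<le> 1" by (simp add: prod_dividef)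
    moreover have "(\<Prod>j\<in>J. c j) > 0" using c by (intro prod_pos) auto
    ultimately have "(\<integral>z. (\<Prod>j\<in>J. f j z) \<partial>M) \<le> (\<Prod>j\<in>J. c j)" by (simp add: field_simps)
    then show ?thesis by (simp add: c_def I_def n_def)
  qed
qed

section \<open>Integrals of products of functionals\<close>

lemma continuous_map_product_dual_eval:
  assumes "j \<in> I"
  shows "continuous_map (product_topology (\<lambda>_. dual_ball_topology sE) I) euclidean (\<lambda>\<phi>. \<phi> j y)"
  using continuous_map_compose[OF continuous_map_product_projection[OF assms] continuous_map_dual_ball_eval]
  by (simp add: comp_def)

lemma norm_prod_powr:
  fixes f :: "'i \<Rightarrow> 'k::real_normed_field"
  shows "norm (\<Prod>j\<in>J. f j) powr p = (\<Prod>j\<in>J. norm (f j) powr p)"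
  by (simp add: prod_norm[symmetric] prod_powr_distrib)

context
  fixes sE :: "'k::real_or_complex \<Rightarrow> 'e::banach \<Rightarrow> 'e" and n :: nat and \<mu>
  assumes sE: "banach_over sE"
    and \<mu>: "regular_borel_prob (product_topology (\<lambda>_. dual_ball_topology sE) {..<n}) \<mu>"
begin

lemma semi_integral_component:
  assumes "\<phi> \<in> space \<mu>" "j < n"
  shows "\<phi> j \<in> dual_ball sE"
  using assms regular_borel_probD(3)[OF \<mu>] by (auto simp: PiE_iff)

lemma semi_integral_measurable:
  assumes "j < n"
  shows "(\<lambda>\<phi>. norm (\<phi> j y) powr p) \<in> borel_measurable \<mu>"
proof -
  have "(\<lambda>\<phi>. \<phi> j y) \<in> borel_measurable (borel_of (product_topology (\<lambda>_. dual_ball_topology sE) {..<n}))"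
    using assms by (intro continuous_map_borel_measurable continuous_map_product_dual_eval) simp
  then have "(\<lambda>\<phi>. \<phi> j y) \<in> borel_measurable \<mu>"
    using regular_borel_probD(2)[OF \<mu>] measurable_cong_sets by blast
  then show ?thesis by measurable
qed

lemma semi_integral_integrable_prod:
  assumes "J \<subseteq> {..<n}" "0 \<le> p"
  shows "integrable \<mu> (\<lambda>\<phi>. \<Prod>j\<in>J. norm (\<phi> j (x j)) powr p)"
proof -
  interpret prob_space \<mu> by (rule regular_borel_probD(1)[OF \<mu>])
  show ?thesis
  proof (rule integrable_const_bound[where B="\<Prod>j\<in>J. norm (x j) powr p"])
    show "(\<lambda>\<phi>. \<Prod>j\<in>J. norm (\<phi> j (x j)) powr p) \<in> borel_measurable \<mu>"
      using assms by (intro borel_measurable_prod semi_integral_measurable) auto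
    have "(\<Prod>j\<in>J. norm (\<phi> j (x j)) powr p) \<le> (\<Prod>j\<in>J. norm (x j) powr p)" if "\<phi> \<in> space \<mu>" for \<phi>
    proof (rule prod_mono)
      fix j assume "j \<in> J"
      then have "norm (\<phi> j (x j)) \<le> norm (x j)"
        using assms semi_integral_component[OF that] by (intro dual_ballD(3)[OF sE]) auto
      then show "0 \<le> norm (\<phi> j (x j)) powr p \<and> norm (\<phi> j (x j)) powr p \<le> norm (x j) powr p"
        using assms by (auto intro: powr_mono2)
    qed
    then show "AE \<phi> in \<mu>. norm (\<Prod>j\<in>J. norm (\<phi> j (x j)) powr p) \<le> (\<Prod>j\<in>J. norm (x j) powr p)"
      by (auto simp: abs_prod intro!: AE_I2)
  qed
qed

text \<open>A pointwise bound on finite sums of products passes through the integral. With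
  \<open>J\<close> a singleton this serves the absolutely summing type, with \<open>J\<close> the
  set of all indices full summability.\<close>

lemma semi_integral_sum_le:
  assumes "0 < p" "0 \<le> C" "0 \<le> D" "finite A"
    and T: "\<And>a. a \<in> A \<Longrightarrow> t a \<le> C * (\<integral>\<phi>. (\<Prod>j\<in>J. norm (\<phi> j (x a j)) powr p) \<partial>\<mu>) powr (1 / p)"
    and t: "\<And>a. a \<in> A \<Longrightarrow> 0 \<le> t a" and J: "J \<subseteq> {..<n}"
    and D: "\<And>\<phi>. \<phi> \<in> space \<mu> \<Longrightarrow> (\<Sum>a\<in>A. \<Prod>j\<in>J. norm (\<phi> j (x a j)) powr p) \<le> D"
  shows "(\<Sum>a\<in>A. t a powr p) \<le> C powr p * D"
proof -
  interpret prob_space \<mu> by (rule regular_borel_probD(1)[OF \<mu>])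
  have int: "integrable \<mu> (\<lambda>\<phi>. \<Prod>j\<in>J. norm (\<phi> j (x a j)) powr p)" for a
    using J \<open>0 < p\<close> by (intro semi_integral_integrable_prod) auto
  have "t a powr p \<le> C powr p * (\<integral>\<phi>. (\<Prod>j\<in>J. norm (\<phi> j (x a j)) powr p) \<partial>\<mu>)" if "a \<in> A" for a
  proof -
    have nn: "0 \<le> (\<integral>\<phi>. (\<Prod>j\<in>J. norm (\<phi> j (x a j)) powr p) \<partial>\<mu>)"
      by (intro Bochner_Integration.integral_nonneg prod_nonneg) simp
    have "t a powr p \<le> (C * (\<integral>\<phi>. (\<Prod>j\<in>J. norm (\<phi> j (x a j)) powr p) \<partial>\<mu>) powr (1 / p)) powr p"
      using T[OF that] t[OF that] \<open>0 < p\<close> by (intro powr_mono2) auto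
    then show ?thesis using \<open>0 < p\<close> nn by (simp add: powr_mult powr_powr)
  qed
  then have "(\<Sum>a\<in>A. t a powr p) \<le> (\<Sum>a\<in>A. C powr p * (\<integral>\<phi>. (\<Prod>j\<in>J. norm (\<phi> j (x a j)) powr p) \<partial>\<mu>))"
    by (rule sum_mono)
  also have "\<dots> = C powr p * (\<integral>\<phi>. (\<Sum>a\<in>A. \<Prod>j\<in>J. norm (\<phi> j (x a j)) powr p) \<partial>\<mu>)"
    using int by (simp add: sum_distrib_left[symmetric] Bochner_Integration.integral_sum)
  also have "\<dots> \<le> C powr p * D"
    using D int by (intro mult_left_mono integral_le_const AE_I2) auto
  finally show ?thesis .
qed

end

section \<open>Tensor products of functionals\<close>

definition tensor_form :: "nat \<Rightarrow> (nat \<Rightarrow> 'e \<Rightarrow> 'k::comm_monoid_mult) \<Rightarrow> (nat \<Rightarrow> 'e) \<Rightarrow> 'k" where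
  "tensor_form n \<phi> x = (\<Prod>j<n. \<phi> j (x j))"

lemma continuous_map_field_prod:
  fixes f :: "'a \<Rightarrow> 'i \<Rightarrow> 'k::real_normed_field"
  assumes "\<And>i. i \<in> I \<Longrightarrow> continuous_map X euclidean (\<lambda>x. f x i)"
  shows "continuous_map X euclidean (\<lambda>x. \<Prod>i\<in>I. f x i)"
  using assms by (simp add: continuous_map_atin tendsto_prod)

lemma continuous_map_field_mult_left:
  fixes f :: "'a \<Rightarrow> 'k::real_normed_field"
  assumes "continuous_map X euclidean f"
  shows "continuous_map X euclidean (\<lambda>x. c * f x)"
  using assms by (simp add: continuous_map_atin tendsto_mult)

lemma tensor_form_multilinear:
  assumes sE: "banach_over sE" and \<phi>: "\<And>j. j < n \<Longrightarrow> \<phi> j \<in> dual_ball sE"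
  shows "tensor_form n \<phi> \<in> cont_multilinear_maps sE (*) {..<n}"
proof -
  have upd: "tensor_form n \<phi> (x(i := y)) = \<phi> i y * (\<Prod>j\<in>{..<n} - {i}. \<phi> j (x j))" if "i < n" for x i y
    unfolding tensor_form_def using that by (subst prod.remove[of _ i]) auto
  have "tensor_form n \<phi> \<in> multilinear_maps sE (*) {..<n}"
    unfolding multilinear_maps_iff[OF sE vector_space_field]
  proof (intro conjI allI ballI)
    show "tensor_form n \<phi> (restrict x {..<n}) = tensor_form n \<phi> x" for x
      by (simp add: tensor_form_def)
    fix i x y z c assume "i \<in> {..<n}"
    then have i: "i < n" by simp
    show "tensor_form n \<phi> (x(i := y + z)) = tensor_form n \<phi> (x(i := y)) + tensor_form n \<phi> (x(i := z))"
      using dual_ballD(1)[OF sE \<phi>[OF i]] by (simp add: upd[OF i] linear_simps algebra_simps)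
    show "tensor_form n \<phi> (x(i := sE c y)) = c * tensor_form n \<phi> (x(i := y))"
      using dual_ballD(2)[OF sE \<phi>[OF i]] by (simp add: upd[OF i])
  qed
  moreover have "continuous_map (product_topology (\<lambda>_. euclidean) {..<n}) euclidean (tensor_form n \<phi>)"
    unfolding tensor_form_def
  proof (rule continuous_map_field_prod)
    fix j assume j: "j \<in> {..<n}"
    then have "continuous_map euclidean euclidean (\<phi> j)"
      using dual_ballD(1)[OF sE \<phi>[of j]] by (simp add: linear_continuous_on)
    from continuous_map_compose[OF continuous_map_product_projection[OF j] this]
    show "continuous_map (product_topology (\<lambda>_. euclidean) {..<n}) euclidean (\<lambda>x. \<phi> j (x j))"
      by (simp add: comp_def)
  qed
  ultimately show ?thesis by (simp add: cont_multilinear_maps_def)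
qed

lemma norm_tensor_form_le:
  assumes sE: "banach_over sE" and \<phi>: "\<And>j. j < n \<Longrightarrow> \<phi> j \<in> dual_ball sE"
  shows "norm (tensor_form n \<phi> x) \<le> (\<Prod>j<n. norm (x j))"
  unfolding tensor_form_def prod_norm[symmetric]
  using dual_ballD(3)[OF sE \<phi>] by (intro prod_mono) auto

lemma tensor_form_in_ball:
  assumes sE: "banach_over sE" and \<phi>: "\<And>j. j < n \<Longrightarrow> \<phi> j \<in> dual_ball sE"
  shows "tensor_form n \<phi> \<in> multiform_ball sE {..<n}"
proof -
  have "multilinear_norm {..<n} (tensor_form n \<phi>) \<le> 1"
    unfolding multilinear_norm_def
  proof (rule cSUP_least)
    show "{x :: nat \<Rightarrow> 'b. \<forall>i\<in>{..<n}. norm (x i) \<le> 1} \<noteq> {}" by (auto intro!: exI[of _ "\<lambda>_. 0"])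
    fix x :: "nat \<Rightarrow> 'b" assume "x \<in> {x. \<forall>i\<in>{..<n}. norm (x i) \<le> 1}"
    then have le: "(\<Prod>j<n. norm (x j)) \<le> 1" by (intro prod_le_1) auto
    show "norm (tensor_form n \<phi> x) \<le> 1"
      by (rule order_trans[OF norm_tensor_form_le[OF sE \<phi>] le])
  qed
  then show ?thesis using tensor_form_multilinear[OF sE \<phi>] by (simp add: multiform_ball_def)
qed

section \<open>Projective norm and the weak-star topology on multilinear forms\<close>

lemma tensor_eval_Nil [simp]: "tensor_eval A [] = 0"
  and tensor_eval_Cons [simp]: "tensor_eval A (cx # u) = fst cx * A (snd cx) + tensor_eval A u"
  by (simp_all add: tensor_eval_def case_prod_beta)

lemma tensor_eval_tensor_diff: "tensor_eval A (tensor_diff u v) = tensor_eval A u - tensor_eval A v"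
proof -
  have "tensor_eval A (map (\<lambda>(c, x). (- c, x)) v) = - tensor_eval A v"
    by (induction v) auto
  moreover have "tensor_eval A (u @ w) = tensor_eval A u + tensor_eval A w" for w
    by (induction u) (auto simp: algebra_simps)
  ultimately show ?thesis by (simp add: tensor_diff_def)
qed

lemma projective_sum_nonneg:
  fixes v :: "('k::real_normed_field, 'e::real_normed_vector) formal_tensor"
  shows "0 \<le> (\<Sum>(c, x)\<leftarrow>v. norm c * (\<Prod>i\<in>I. norm (x i)))"
  by (intro sum_list_nonneg) (auto intro!: mult_nonneg_nonneg prod_nonneg)

text \<open>The value at a tensor does not depend on the list that represents it, and every
  representing list bounds it by its own cost because the functionals have norm at most 1. The bound
  does not involve the functionals, which makes limits along Cauchy sequences uniform.\<close>

lemma norm_tensor_eval_le_projective_norm: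
  assumes sE: "banach_over sE" and \<phi>: "\<And>j. j < n \<Longrightarrow> \<phi> j \<in> dual_ball sE"
  shows "norm (tensor_eval (tensor_form n \<phi>) u) \<le> projective_norm sE {..<n} u"
  unfolding projective_norm_def
proof (rule cInf_greatest)
  show "{(\<Sum>(c, x)\<leftarrow>v. norm c * (\<Prod>i<n. norm (x i))) | v. tensor_eq sE {..<n} u v} \<noteq> {}"
    by (auto simp: tensor_eq_def)
  fix s assume "s \<in> {(\<Sum>(c, x)\<leftarrow>v. norm c * (\<Prod>i<n. norm (x i))) | v. tensor_eq sE {..<n} u v}"
  then obtain v where v: "s = (\<Sum>(c, x)\<leftarrow>v. norm c * (\<Prod>i<n. norm (x i)))" "tensor_eq sE {..<n} u v"
    by blast
  have "tensor_form n \<phi> \<in> multilinear_maps sE (*) {..<n}"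
    using tensor_form_multilinear[OF sE \<phi>] by (simp add: cont_multilinear_maps_def)
  then have "tensor_eval (tensor_form n \<phi>) u = tensor_eval (tensor_form n \<phi>) v"
    using v(2) by (simp add: tensor_eq_def)
  moreover have "norm (tensor_eval (tensor_form n \<phi>) v) \<le> (\<Sum>(c, x)\<leftarrow>v. norm c * (\<Prod>i<n. norm (x i)))"
  proof (induction v)
    case (Cons cx v)
    have "norm (fst cx * tensor_form n \<phi> (snd cx)) \<le> norm (fst cx) * (\<Prod>i<n. norm (snd cx i))"
      unfolding norm_mult using norm_tensor_form_le[OF sE \<phi>] by (intro mult_left_mono) auto
    from norm_triangle_mono[OF this Cons] show ?case by (simp add: case_prod_beta)
  qed simp
  ultimately show "norm (tensor_eval (tensor_form n \<phi>) u) \<le> s" using v(1) by simp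
qed

text \<open>The difference of a tensor with itself is also represented by the empty list, of cost
  0.\<close>

lemma projective_Cauchy_const: "projective_Cauchy sE I (\<lambda>_. u)"
proof -
  have "projective_norm sE I (tensor_diff u u) \<le> 0"
    unfolding projective_norm_def
  proof (rule cInf_lower)
    show "0 \<in> {(\<Sum>(c, x)\<leftarrow>v. norm c * (\<Prod>i\<in>I. norm (x i))) | v. tensor_eq sE I (tensor_diff u u) v}"
      by (auto simp: tensor_eq_def tensor_eval_tensor_diff intro!: exI[of _ "[]"])
    show "bdd_below {(\<Sum>(c, x)\<leftarrow>v. norm c * (\<Prod>i\<in>I. norm (x i))) | v. tensor_eq sE I (tensor_diff u u) v}"
      using projective_sum_nonneg by (intro bdd_belowI[of _ 0]) blast
  qed
  then show ?thesis unfolding projective_Cauchy_def by (meson le_less_trans)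
qed

text \<open>Evaluation at \<open>x\<close> is the action of an elementary tensor, represented by a
  constant sequence. Hence the weak-star topology makes evaluations continuous and is
  Hausdorff.\<close>

lemma multiform_eval_functional:
  "(\<lambda>\<phi>. \<phi> x) \<in> {\<lambda>\<phi>. lim (\<lambda>m. tensor_eval \<phi> (u m)) | u. projective_Cauchy sE I u}"
  by (rule CollectI, rule exI[of _ "\<lambda>_. [(1, x)]"]) (simp add: projective_Cauchy_const)

lemma continuous_map_multiform_eval:
  "continuous_map (multiform_ball_topology sE I) euclidean (\<lambda>\<phi>. \<phi> x)"
  unfolding multiform_ball_topology_def
  by (intro continuous_map_from_subtopology continuous_map_initial_topology multiform_eval_functional)

lemma Hausdorff_multiform_ball_topology:
  fixes sE :: "'k::real_normed_field \<Rightarrow> 'e::real_normed_vector \<Rightarrow> 'e"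
  shows "Hausdorff_space (multiform_ball_topology sE I)"
  unfolding multiform_ball_topology_def
proof (intro Hausdorff_space_subtopology Hausdorff_space_initial_topology)
  show "{\<lambda>\<phi>. lim (\<lambda>m. tensor_eval \<phi> (u m)) | u. projective_Cauchy sE I u} \<noteq> {}"
    using multiform_eval_functional by blast
  fix \<phi> \<psi> :: "(nat \<Rightarrow> 'e) \<Rightarrow> 'k" assume "\<phi> \<noteq> \<psi>"
  then obtain x where "\<phi> x \<noteq> \<psi> x" by blast
  then show "\<exists>g\<in>{\<lambda>\<phi>. lim (\<lambda>m. tensor_eval \<phi> (u m)) | u. projective_Cauchy sE I u}. g \<phi> \<noteq> g \<psi>"
    by (intro bexI[where x="\<lambda>\<phi>. \<phi> x"] multiform_eval_functional)
qed

text \<open>On a finite tensor the value is a finite sum of multiples of products of evaluations,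
  hence continuous in the functionals. On an element of the completion it is a uniform limit of such
  functions.\<close>

lemma continuous_map_tensor_form:
  fixes sE :: "'k::real_or_complex \<Rightarrow> 'e::banach \<Rightarrow> 'e"
  assumes sE: "banach_over sE"
  shows "continuous_map (product_topology (\<lambda>_. dual_ball_topology sE) {..<n})
    (multiform_ball_topology sE {..<n}) (tensor_form n)"
proof -
  let ?Z = "product_topology (\<lambda>_. dual_ball_topology sE) {..<n}"
  have comp: "\<phi> j \<in> dual_ball sE" if "\<phi> \<in> topspace ?Z" "j < n" for \<phi> j
    using that by (auto simp: PiE_iff)
  have cont: "continuous_map ?Z euclidean (\<lambda>\<phi>. tensor_eval (tensor_form n \<phi>) u)" for u
  proof (induction u)
    case (Cons cx u)
    have "continuous_map ?Z euclidean (\<lambda>\<phi>. tensor_form n \<phi> (snd cx))"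
      unfolding tensor_form_def
      by (intro continuous_map_field_prod continuous_map_product_dual_eval)
    then show ?case using Cons by (simp add: continuous_map_add continuous_map_field_mult_left)
  qed simp
  have "continuous_map ?Z euclidean (\<lambda>\<phi>. lim (\<lambda>m. tensor_eval (tensor_form n \<phi>) (u m)))"
    if u: "projective_Cauchy sE {..<n} u" for u
  proof -
    let ?t = "\<lambda>m \<phi>. tensor_eval (tensor_form n \<phi>) (u m)"
    have close: "\<exists>N. \<forall>k\<ge>N. \<forall>l\<ge>N. \<forall>\<phi>\<in>topspace ?Z. dist (?t k \<phi>) (?t l \<phi>) < \<epsilon>" if "0 < \<epsilon>" for \<epsilon>
    proof -
      obtain N where N: "\<And>k l. k \<ge> N \<Longrightarrow> l \<ge> N \<Longrightarrow> projective_norm sE {..<n} (tensor_diff (u k) (u l)) < \<epsilon>"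
        using u \<open>0 < \<epsilon>\<close> unfolding projective_Cauchy_def by meson
      have "dist (?t k \<phi>) (?t l \<phi>) < \<epsilon>" if "k \<ge> N" "l \<ge> N" "\<phi> \<in> topspace ?Z" for k l \<phi>
        using le_less_trans[OF norm_tensor_eval_le_projective_norm[OF sE comp[OF that(3)]] N[OF that(1,2)]]
        by (simp add: dist_norm tensor_eval_tensor_diff)
      then show ?thesis by blast
    qed
    have lims: "(\<lambda>m. ?t m \<phi>) \<longlonglongrightarrow> lim (\<lambda>m. ?t m \<phi>)" if "\<phi> \<in> topspace ?Z" for \<phi>
    proof -
      have "Cauchy (\<lambda>m. ?t m \<phi>)" unfolding Cauchy_def using close that by meson
      then show ?thesis using Cauchy_convergent convergent_LIMSEQ_iff by blast
    qed
    have "continuous_map ?Z Met_TC.mtopology (\<lambda>\<phi>. lim (\<lambda>m. ?t m \<phi>))"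
    proof (rule Met_TC.continuous_map_uniform_limit[where F=sequentially])
      show "\<forall>\<^sub>F m in sequentially. continuous_map ?Z Met_TC.mtopology (?t m)"
        using cont by simp
      fix \<epsilon> :: real assume "0 < \<epsilon>"
      \<comment> \<open>The tolerance is halved because the strict inequality becomes weak in the
        limit over \<open>l\<close>.\<close>
      then obtain N where N: "\<And>k l \<phi>. k \<ge> N \<Longrightarrow> l \<ge> N \<Longrightarrow> \<phi> \<in> topspace ?Z \<Longrightarrow>
          dist (?t k \<phi>) (?t l \<phi>) < \<epsilon> / 2"
        using close[OF half_gt_zero] by meson
      have "dist (?t k \<phi>) (lim (\<lambda>m. ?t m \<phi>)) < \<epsilon>" if "k \<ge> N" "\<phi> \<in> topspace ?Z" for k \<phi>
      proof -
        have "(\<lambda>l. dist (?t k \<phi>) (?t l \<phi>)) \<longlonglongrightarrow> dist (?t k \<phi>) (lim (\<lambda>m. ?t m \<phi>))"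
          by (intro tendsto_dist tendsto_const lims that)
        then have "dist (?t k \<phi>) (lim (\<lambda>m. ?t m \<phi>)) \<le> \<epsilon> / 2"
          by (rule LIMSEQ_le_const2) (use N[OF that(1) _ that(2)] in \<open>blast intro: less_imp_le\<close>)
        then show ?thesis using \<open>0 < \<epsilon>\<close> by linarith
      qed
      then show "\<forall>\<^sub>F k in sequentially. \<forall>\<phi>\<in>topspace ?Z. lim (\<lambda>m. ?t m \<phi>) \<in> UNIV \<and>
          dist (?t k \<phi>) (lim (\<lambda>m. ?t m \<phi>)) < \<epsilon>"
        unfolding eventually_sequentially by blast
    qed simp
    then show ?thesis by simp
  qed
  then have "continuous_map ?Z (initial_topology (cont_multilinear_maps sE (*) {..<n})
      {\<lambda>\<phi>. lim (\<lambda>m. tensor_eval \<phi> (u m)) | u. projective_Cauchy sE {..<n} u}) (tensor_form n)"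
    using multiform_eval_functional comp
    by (intro continuous_map_into_initial_topology image_subsetI tensor_form_multilinear[OF sE]) blast+
  then show ?thesis
    unfolding multiform_ball_topology_def continuous_map_in_subtopology
    using comp by (intro conjI funcsetI tensor_form_in_ball[OF sE])
qed

section \<open>Inclusions between the classes\<close>

lemma multilinear_eq_zero:
  assumes sE: "banach_over sE" and sF: "banach_over sF" and T: "T \<in> multilinear_maps sE sF I"
    and j: "j \<in> I" "x j = 0"
  shows "T x = 0"
proof -
  interpret F: banach_over sF by fact
  have "T (x(j := 0 + 0)) = T (x(j := 0)) + T (x(j := 0))"
    using T j(1) unfolding multilinear_maps_iff[OF sE F.vector_space_axioms] by blast
  moreover have "x(j := 0) = x" using j(2) by auto
  ultimately show ?thesis by simp
qed

text \<open>Continuity makes the set under the supremum bounded, so that the real \<open>SUP\<close>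
  is an upper bound; \<open>max 1 (norm y)\<close> accounts for the unrestricted variable
  \<open>j\<close>.\<close>

lemma norm_le_multilinear_norm_separate:
  assumes sE: "banach_over sE" and sF: "banach_over sF"
    and T: "T \<in> cont_multilinear_maps sE sF {..<n}" and j: "j < n"
    and x: "\<And>i. i \<in> {..<n} - {j} \<Longrightarrow> norm (x i) \<le> 1"
  shows "norm (T (x(j := y))) \<le> multilinear_norm ({..<n} - {j}) (separate_var j T y)"
proof -
  obtain K where K: "K \<ge> 0" "\<And>x B. B \<ge> 0 \<Longrightarrow> (\<And>i. i \<in> {..<n} \<Longrightarrow> norm (x i) \<le> B) \<Longrightarrow>
      norm (T x) \<le> K * B ^ card {..<n}"
    using cont_multilinear_bounded[OF sE sF _ T] by auto
  have "norm (separate_var j T y x) \<le> K * max 1 (norm y) ^ card {..<n}"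
    if "x \<in> {x. \<forall>i\<in>{..<n} - {j}. norm (x i) \<le> 1}" for x
    unfolding separate_var_def using that by (intro K(2)) (auto simp: max.coboundedI1)
  then have "bdd_above ((\<lambda>x. norm (separate_var j T y x)) ` {x. \<forall>i\<in>{..<n} - {j}. norm (x i) \<le> 1})"
    by (intro bdd_aboveI2)
  then have "norm (separate_var j T y x) \<le> multilinear_norm ({..<n} - {j}) (separate_var j T y)"
    unfolding multilinear_norm_def using x by (intro cSUP_upper) auto
  then show ?thesis by (simp add: separate_var_def)
qed

lemma multilinear_norm_separate_nonneg:
  assumes "banach_over sE" "banach_over sF" "T \<in> cont_multilinear_maps sE sF {..<n}" "j < n"
  shows "0 \<le> multilinear_norm ({..<n} - {j}) (separate_var j T y)"
  using norm_le_multilinear_norm_separate[OF assms, of "\<lambda>_. 0" y] order_trans[OF norm_ge_zero] by simp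

lemma norm_le_multilinear_norm_separate_scaled:
  assumes sE: "banach_over sE" and sF: "banach_over sF"
    and T: "T \<in> cont_multilinear_maps sE sF {..<n}" and j: "j < n" and B: "0 < B"
    and x: "\<And>i. i \<in> {..<n} - {j} \<Longrightarrow> norm (x i) \<le> B"
  shows "norm (T x) \<le> B ^ card ({..<n} - {j}) * multilinear_norm ({..<n} - {j}) (separate_var j T (x j))"
proof -
  let ?J = "{..<n} - {j}"
  have ml: "T \<in> multilinear_maps sE sF {..<n}" using T by (simp add: cont_multilinear_maps_def)
  have "T ((\<lambda>i. (1 / B) *\<^sub>R x i)(j := x j)) = T (\<lambda>i. if i \<in> ?J then (1 / B) *\<^sub>R x i else x i)"
    using ml by (rule multilinear_cong) auto
  also have "\<dots> = (1 / B) ^ card ?J *\<^sub>R T x"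
    by (rule multilinear_scaleR[OF sE sF ml]) auto
  finally have "(1 / B) ^ card ?J * norm (T x) = norm (T ((\<lambda>i. (1 / B) *\<^sub>R x i)(j := x j)))"
    using B by simp
  also have "\<dots> \<le> multilinear_norm ?J (separate_var j T (x j))"
    using x B by (intro norm_le_multilinear_norm_separate[OF sE sF T j]) (simp add: field_simps)
  finally show ?thesis using B by (simp add: field_simps)
qed

text \<open>Bounded sequences in the variables other than \<open>j\<close> cost only a power of
  their common bound; the remaining variable is controlled by the summing operator.\<close>

lemma summing_type_subset_as_maps:
  assumes sE: "banach_over sE" and sF: "banach_over sF" and p: "0 < p" and j: "j < n"
  shows "summing_type_maps sE sF n p \<subseteq> as_maps sE sF n p (\<lambda>s. if s = j then ereal p else \<infinity>)"
proof
  fix T assume "T \<in> summing_type_maps sE sF n p"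
  then have T: "T \<in> cont_multilinear_maps sE sF {..<n}"
    and as: "absolutely_summing sE (multilinear_norm ({..<n} - {j})) p (separate_var j T)"
    using j by (auto simp: summing_type_maps_def)
  have "(\<lambda>m. T (\<lambda>s. 0 + x s m) - T (\<lambda>_. 0)) \<in> lp norm p"
    if x: "\<forall>s<n. x s \<in> weak_lp sE (if s = j then ereal p else \<infinity>)" for x
  proof -
    have "\<forall>s\<in>{..<n} - {j}. \<exists>b>0. \<forall>m. norm (x s m) \<le> b"
    proof
      fix s assume s: "s \<in> {..<n} - {j}"
      then have "x s \<in> weak_lp sE \<infinity>" using x by auto
      then show "\<exists>b>0. \<forall>m. norm (x s m) \<le> b" by (simp add: weak_lp_def bounded_pos)
    qed
    then obtain b where b: "\<And>s m. s \<in> {..<n} - {j} \<Longrightarrow> norm (x s m) \<le> b s" by metis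
    \<comment> \<open>The 1 makes the bound positive and covers the case of no further
      variables.\<close>
    define B where "B = Max (insert 1 (b ` ({..<n} - {j})))"
    have "1 \<le> B" unfolding B_def by (intro Max_ge) auto
    then have B0: "0 < B" by simp
    have "b s \<le> B" if "s \<in> {..<n} - {j}" for s unfolding B_def using that by (intro Max_ge) auto
    then have xB: "norm (x s m) \<le> B" if "s \<in> {..<n} - {j}" for s m
      using b[OF that, of m] that by (meson order_trans)
    let ?\<Psi> = "\<lambda>m. multilinear_norm ({..<n} - {j}) (separate_var j T (x j m))"
    have \<Psi>0: "0 \<le> ?\<Psi> m" for m by (rule multilinear_norm_separate_nonneg[OF sE sF T j])
    have "x j \<in> weak_lp sE (ereal p)" using x j by auto
    then have "summable (\<lambda>m. ?\<Psi> m powr p)" using as by (auto simp: absolutely_summing_def lp_def)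
    then have sm: "summable (\<lambda>m. (B ^ card ({..<n} - {j})) powr p * ?\<Psi> m powr p)"
      by (rule summable_mult)
    have "norm (T (\<lambda>s. x s m)) powr p \<le> (B ^ card ({..<n} - {j})) powr p * ?\<Psi> m powr p" for m
    proof -
      have "norm (T (\<lambda>s. x s m)) \<le> B ^ card ({..<n} - {j}) * ?\<Psi> m"
        using norm_le_multilinear_norm_separate_scaled[OF sE sF T j B0, of "\<lambda>s. x s m"] xB by blast
      then have "norm (T (\<lambda>s. x s m)) powr p \<le> (B ^ card ({..<n} - {j}) * ?\<Psi> m) powr p"
        using p by (intro powr_mono2) auto
      then show ?thesis using B0 \<Psi>0 by (simp add: powr_mult)
    qed
    then have "summable (\<lambda>m. norm (T (\<lambda>s. x s m)) powr p)"
      by (intro summable_comparison_test'[OF sm, of 0]) simp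
    moreover have "T (\<lambda>_. 0) = 0"
      using T j by (intro multilinear_eq_zero[OF sE sF]) (auto simp: cont_multilinear_maps_def)
    ultimately show ?thesis by (simp add: lp_def)
  qed
  then show "T \<in> as_maps sE sF n p (\<lambda>s. if s = j then ereal p else \<infinity>)"
    using T by (simp add: as_maps_def summing_at_def)
qed

text \<open>For each \<open>m\<close> a point of the unit ball attains the norm of the operator at
  \<open>x m\<close> up to a factor 2. The coordinates of these points are bounded sequences,
  admissible where the index is \<open>\<infinity>\<close>, so summability of the attained values
  gives summability of the norms.\<close>

lemma as_maps_subset_summing_type:
  fixes sE :: "'k::real_or_complex \<Rightarrow> 'e::banach \<Rightarrow> 'e"
  assumes sE: "banach_over sE" and sF: "banach_over sF" and p: "0 < p" and n: "0 < n"
  shows "(\<Inter>j\<in>{..<n}. as_maps sE sF n p (\<lambda>s. if s = j then ereal p else \<infinity>)) \<subseteq> summing_type_maps sE sF n p"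
proof
  fix T assume T_all: "T \<in> (\<Inter>j\<in>{..<n}. as_maps sE sF n p (\<lambda>s. if s = j then ereal p else \<infinity>))"
  then have T: "T \<in> cont_multilinear_maps sE sF {..<n}" using n by (auto simp: as_maps_def)
  have "(\<lambda>m. separate_var j T (x m)) \<in> lp (multilinear_norm ({..<n} - {j})) p"
    if j: "j < n" and x: "x \<in> weak_lp sE (ereal p)" for j x
  proof -
    let ?\<Psi> = "\<lambda>m. multilinear_norm ({..<n} - {j}) (separate_var j T (x m))"
    let ?ball = "{y :: nat \<Rightarrow> 'e. \<forall>i\<in>{..<n} - {j}. norm (y i) \<le> 1}"
    have \<Psi>0: "0 \<le> ?\<Psi> m" for m by (rule multilinear_norm_separate_nonneg[OF sE sF T j])
    \<comment> \<open>If the factor 2 failed, the norm would be positive and at most half of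
      itself.\<close>
    have "\<exists>y\<in>?ball. ?\<Psi> m \<le> 2 * norm (T (y(j := x m)))" for m
    proof (rule ccontr)
      assume none: "\<not> ?thesis"
      have less: "2 * norm (T (y(j := x m))) < ?\<Psi> m" if "y \<in> ?ball" for y
        using none that not_le by blast
      have "(\<lambda>_. 0) \<in> ?ball" by simp
      from le_less_trans[OF _ less[OF this]] have "0 < ?\<Psi> m" by simp
      moreover have "?\<Psi> m \<le> ?\<Psi> m / 2"
      proof -
        have le: "norm (separate_var j T (x m) y) \<le> ?\<Psi> m / 2" if "y \<in> ?ball" for y
          using less[OF that] by (simp add: separate_var_def)
        have "(SUP y\<in>?ball. norm (separate_var j T (x m) y)) \<le> ?\<Psi> m / 2"
          by (rule cSUP_least[OF _ le]) (auto intro: exI[of _ "\<lambda>_. 0"])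
        then show ?thesis by (simp only: multilinear_norm_def)
      qed
      ultimately show False by simp
    qed
    then have "\<forall>m. \<exists>y. y \<in> ?ball \<and> ?\<Psi> m \<le> 2 * norm (T (y(j := x m)))" by blast
    from choice[OF this] obtain y
      where y: "\<And>m. y m \<in> ?ball" "\<And>m. ?\<Psi> m \<le> 2 * norm (T ((y m)(j := x m)))"
      by blast
    define X where "X s m = ((y m)(j := x m)) s" for s m
    have "\<forall>s<n. X s \<in> weak_lp sE (if s = j then ereal p else \<infinity>)"
    proof (intro allI impI)
      fix s assume s: "s < n"
      show "X s \<in> weak_lp sE (if s = j then ereal p else \<infinity>)"
      proof (cases "s = j")
        case True
        then have "X s = x" by (auto simp: X_def)
        then show ?thesis using x True by simp
      next
        case False
        then have "norm (X s m) \<le> 1" for m using y(1)[of m] s by (auto simp: X_def)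
        then show ?thesis using False by (auto simp: weak_lp_def bounded_iff)
      qed
    qed
    moreover have "summing_at sE n p (\<lambda>s. if s = j then ereal p else \<infinity>) T (\<lambda>_. 0)"
      using T_all j by (auto simp: as_maps_def)
    ultimately have "(\<lambda>m. T (\<lambda>s. 0 + X s m) - T (\<lambda>_. 0)) \<in> lp norm p"
      unfolding summing_at_def by blast
    moreover have "T (\<lambda>_. 0) = 0"
      using T j by (intro multilinear_eq_zero[OF sE sF]) (auto simp: cont_multilinear_maps_def)
    moreover have "(\<lambda>s. X s m) = (y m)(j := x m)" for m by (auto simp: X_def)
    ultimately have "summable (\<lambda>m. norm (T ((y m)(j := x m))) powr p)" by (simp add: lp_def)
    then have sm: "summable (\<lambda>m. 2 powr p * norm (T ((y m)(j := x m))) powr p)"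
      by (rule summable_mult)
    have "?\<Psi> m powr p \<le> 2 powr p * norm (T ((y m)(j := x m))) powr p" for m
    proof -
      have "?\<Psi> m powr p \<le> (2 * norm (T ((y m)(j := x m)))) powr p"
        using p \<Psi>0 y(2)[of m] by (intro powr_mono2) auto
      then show ?thesis by (simp add: powr_mult)
    qed
    then have "summable (\<lambda>m. ?\<Psi> m powr p)"
      by (intro summable_comparison_test'[OF sm, of 0]) simp
    then show ?thesis by (simp add: lp_def)
  qed
  then show "T \<in> summing_type_maps sE sF n p"
    using T by (simp add: summing_type_maps_def absolutely_summing_def)
qed

section \<open>Semi-integral maps compared with dominated and summing ones\<close>

lemma dual_ball_integrable:
  fixes sE :: "'k::real_or_complex \<Rightarrow> 'e::banach \<Rightarrow> 'e"
  assumes sE: "banach_over sE" and M: "regular_borel_prob (dual_ball_topology sE) M" and "0 \<le> p"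
  shows "integrable M (\<lambda>\<phi>. norm (\<phi> y) powr p)"
proof -
  interpret prob_space M by (rule regular_borel_probD(1)[OF M])
  have "(\<lambda>\<phi>. \<phi> y) \<in> borel_measurable (borel_of (dual_ball_topology sE))"
    by (intro continuous_map_borel_measurable continuous_map_dual_ball_eval)
  then have "(\<lambda>\<phi>. \<phi> y) \<in> borel_measurable M"
    using regular_borel_probD(2)[OF M] measurable_cong_sets by blast
  then have "(\<lambda>\<phi>. norm (\<phi> y) powr p) \<in> borel_measurable M" by measurable
  moreover have "norm (\<phi> y) powr p \<le> norm y powr p" if "\<phi> \<in> space M" for \<phi>
    using that regular_borel_probD(3)[OF M] dual_ballD(3)[OF sE] \<open>0 \<le> p\<close> by (intro powr_mono2) auto
  ultimately show ?thesis
    by (intro integrable_const_bound[where B="norm y powr p"]) auto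
qed

lemma dominated_subset_semi_integral:
  assumes sE: "banach_over sE" and p: "0 < p"
  shows "dominated_maps sE sF n p \<subseteq> semi_integral_maps sE sF n p"
proof
  fix T assume "T \<in> dominated_maps sE sF n p"
  then obtain C \<mu> where T: "T \<in> cont_multilinear_maps sE sF {..<n}" and C: "C \<ge> 0"
    and \<mu>: "\<And>j. j < n \<Longrightarrow> regular_borel_prob (dual_ball_topology sE) (\<mu> j)"
    and TC: "\<And>x. norm (T x) \<le> C * (\<Prod>j<n. (\<integral>\<phi>. norm (\<phi> (x j)) powr p \<partial>\<mu> j) powr (1 / p))"
    unfolding dominated_maps_def by blast
  obtain P where P: "regular_borel_prob (product_topology (\<lambda>_. dual_ball_topology sE) {..<n}) P"
    and nnP: "\<And>g. (\<forall>j<n. g j \<in> borel_measurable (\<mu> j)) \<Longrightarrow>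
      (\<integral>\<^sup>+z. (\<Prod>j<n. g j (z j)) \<partial>P) = (\<Prod>j<n. \<integral>\<^sup>+y. g j y \<partial>\<mu> j)"
    using regular_borel_prob_product[of n "\<lambda>_. dual_ball_topology sE" \<mu>, OF Hausdorff_dual_ball_topology \<mu>]
    by blast
  have "(\<Prod>j<n. (\<integral>\<phi>. norm (\<phi> (x j)) powr p \<partial>\<mu> j)) = (\<integral>\<phi>. norm (\<Prod>j<n. \<phi> j (x j)) powr p \<partial>P)" for x
  proof -
    have int: "integrable (\<mu> j) (\<lambda>\<phi>. norm (\<phi> (x j)) powr p)" if "j < n" for j
      using p by (intro dual_ball_integrable[OF sE \<mu>[OF that]]) simp
    have intP: "integrable P (\<lambda>\<phi>. \<Prod>j<n. norm (\<phi> j (x j)) powr p)"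
      using p by (intro semi_integral_integrable_prod[OF sE P]) auto
    \<comment> \<open>The product formula concerns nonnegative integrals, hence the passage through
      \<open>ennreal\<close>.\<close>
    have "ennreal (\<integral>\<phi>. (\<Prod>j<n. norm (\<phi> j (x j)) powr p) \<partial>P) =
        (\<integral>\<^sup>+\<phi>. ennreal (\<Prod>j<n. norm (\<phi> j (x j)) powr p) \<partial>P)"
      using intP by (intro nn_integral_eq_integral[symmetric]) (auto intro!: prod_nonneg)
    also have "\<dots> = (\<integral>\<^sup>+\<phi>. (\<Prod>j<n. ennreal (norm (\<phi> j (x j)) powr p)) \<partial>P)"
      by (simp add: prod_ennreal)
    also have "\<dots> = (\<Prod>j<n. \<integral>\<^sup>+\<phi>. ennreal (norm (\<phi> (x j)) powr p) \<partial>\<mu> j)"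
      using borel_measurable_integrable[OF int] by (intro nnP) auto
    also have "\<dots> = (\<Prod>j<n. ennreal (\<integral>\<phi>. norm (\<phi> (x j)) powr p \<partial>\<mu> j))"
      using int by (intro prod.cong nn_integral_eq_integral) auto
    also have "\<dots> = ennreal (\<Prod>j<n. (\<integral>\<phi>. norm (\<phi> (x j)) powr p \<partial>\<mu> j))"
      by (intro prod_ennreal) simp
    finally show ?thesis
      by (simp add: norm_prod_powr prod_nonneg)
  qed
  then have "norm (T x) \<le> C * (\<integral>\<phi>. norm (\<Prod>j<n. \<phi> j (x j)) powr p \<partial>P) powr (1 / p)" for x
    using TC[of x] by (simp add: prod_powr_distrib[symmetric])
  then show "T \<in> semi_integral_maps sE sF n p"
    unfolding semi_integral_maps_def using T C P by blast
qed

lemma semi_integralD: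
  assumes "T \<in> semi_integral_maps sE sF n p"
  shows "\<exists>C \<mu>. T \<in> cont_multilinear_maps sE sF {..<n} \<and> 0 \<le> C \<and>
    regular_borel_prob (product_topology (\<lambda>_. dual_ball_topology sE) {..<n}) \<mu> \<and>
    (\<forall>x. norm (T x) \<le> C * (\<integral>\<phi>. (\<Prod>j<n. norm (\<phi> j (x j)) powr p) \<partial>\<mu>) powr (1 / p))"
  using assms unfolding semi_integral_maps_def norm_prod_powr by blast

text \<open>With the other variables in unit balls, their functionals contribute factors at most 1,
  so the norm of the operator at \<open>x m\<close> is bounded by an integral involving the
  \<open>j\<close>-th functional alone.\<close>

lemma semi_integral_subset_summing_type:
  fixes sE :: "'k::real_or_complex \<Rightarrow> 'e::banach \<Rightarrow> 'e"
  assumes sE: "banach_over sE" and sF: "banach_over sF" and p: "0 < p"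
  shows "semi_integral_maps sE sF n p \<subseteq> summing_type_maps sE sF n p"
proof
  fix T assume "T \<in> semi_integral_maps sE sF n p"
  then obtain C \<mu> where T: "T \<in> cont_multilinear_maps sE sF {..<n}" and C: "C \<ge> 0"
    and \<mu>: "regular_borel_prob (product_topology (\<lambda>_. dual_ball_topology sE) {..<n}) \<mu>"
    and TC: "\<And>x. norm (T x) \<le> C * (\<integral>\<phi>. (\<Prod>j<n. norm (\<phi> j (x j)) powr p) \<partial>\<mu>) powr (1 / p)"
    using semi_integralD by blast
  have "(\<lambda>m. separate_var j T (x m)) \<in> lp (multilinear_norm ({..<n} - {j})) p"
    if j: "j < n" and x: "x \<in> weak_lp sE (ereal p)" for j x
  proof -
    let ?\<Psi> = "\<lambda>m. multilinear_norm ({..<n} - {j}) (separate_var j T (x m))"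
    have \<Psi>0: "0 \<le> ?\<Psi> m" for m by (rule multilinear_norm_separate_nonneg[OF sE sF T j])
    have \<Psi>_le: "?\<Psi> m \<le> C * (\<integral>\<phi>. (\<Prod>i\<in>{j}. norm (\<phi> i (x m)) powr p) \<partial>\<mu>) powr (1 / p)" for m
      unfolding multilinear_norm_def
    proof (rule cSUP_least)
      show "{y :: nat \<Rightarrow> 'e. \<forall>i\<in>{..<n} - {j}. norm (y i) \<le> 1} \<noteq> {}"
        by (auto intro!: exI[of _ "\<lambda>_. 0"])
      fix y :: "nat \<Rightarrow> 'e" assume y: "y \<in> {y. \<forall>i\<in>{..<n} - {j}. norm (y i) \<le> 1}"
      let ?y = "y(j := x m)"
      have le: "(\<integral>\<phi>. (\<Prod>i<n. norm (\<phi> i (?y i)) powr p) \<partial>\<mu>) \<le> (\<integral>\<phi>. (\<Prod>i\<in>{j}. norm (\<phi> i (x m)) powr p) \<partial>\<mu>)"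
      proof (rule integral_mono)
        show "integrable \<mu> (\<lambda>\<phi>. \<Prod>i<n. norm (\<phi> i (?y i)) powr p)"
          using p by (intro semi_integral_integrable_prod[OF sE \<mu>]) auto
        show "integrable \<mu> (\<lambda>\<phi>. \<Prod>i\<in>{j}. norm (\<phi> i (x m)) powr p)"
          using p j by (intro semi_integral_integrable_prod[OF sE \<mu>]) auto
        fix \<phi> assume \<phi>: "\<phi> \<in> space \<mu>"
        have "norm (\<phi> i (?y i)) powr p \<le> 1" if "i \<in> {..<n} - {j}" for i
        proof -
          have "norm (\<phi> i (y i)) \<le> norm (y i)"
            using that semi_integral_component[OF sE \<mu> \<phi>] by (intro dual_ballD(3)[OF sE]) auto
          also have "\<dots> \<le> 1" using y that by auto
          finally show ?thesis using that p by (auto intro!: powr_le1)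
        qed
        then have "(\<Prod>i\<in>{..<n} - {j}. norm (\<phi> i (?y i)) powr p) \<le> 1"
          by (intro prod_le_1) auto
        then have "norm (\<phi> j (x m)) powr p * (\<Prod>i\<in>{..<n} - {j}. norm (\<phi> i (?y i)) powr p) \<le> norm (\<phi> j (x m)) powr p"
          by (intro mult_left_le) auto
        then show "(\<Prod>i<n. norm (\<phi> i (?y i)) powr p) \<le> (\<Prod>i\<in>{j}. norm (\<phi> i (x m)) powr p)"
          using j by (subst prod.remove[of _ j]) auto
      qed
      have "norm (T ?y) \<le> C * (\<integral>\<phi>. (\<Prod>i<n. norm (\<phi> i (?y i)) powr p) \<partial>\<mu>) powr (1 / p)" by (rule TC)
      also have "\<dots> \<le> C * (\<integral>\<phi>. (\<Prod>i\<in>{j}. norm (\<phi> i (x m)) powr p) \<partial>\<mu>) powr (1 / p)"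
        using le p C
        by (intro mult_left_mono powr_mono2 Bochner_Integration.integral_nonneg prod_nonneg) auto
      finally show "norm (separate_var j T (x m) y) \<le> C * (\<integral>\<phi>. (\<Prod>i\<in>{j}. norm (\<phi> i (x m)) powr p) \<partial>\<mu>) powr (1 / p)"
        by (simp add: separate_var_def)
    qed
    have "(\<Sum>m<N. ?\<Psi> m powr p) \<le> C powr p * weak_lp_norm sE p x powr p" for N
    proof (rule semi_integral_sum_le[OF sE \<mu> p C, where J="{j}" and x="\<lambda>m _. x m"])
      show "\<And>m. ?\<Psi> m \<le> C * (\<integral>\<phi>. (\<Prod>i\<in>{j}. norm (\<phi> i (x m)) powr p) \<partial>\<mu>) powr (1 / p)" by (rule \<Psi>_le)
      show "(\<Sum>m<N. \<Prod>i\<in>{j}. norm (\<phi> i (x m)) powr p) \<le> weak_lp_norm sE p x powr p"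
        if "\<phi> \<in> space \<mu>" for \<phi>
        using weak_lp_norm_nonneg_bound(2)[OF sE p x semi_integral_component[OF sE \<mu> that j]] by simp
    qed (use j \<Psi>0 in auto)
    then have "summable (\<lambda>m. ?\<Psi> m powr p)" by (intro summableI_nonneg_bounded) auto
    then show ?thesis by (simp add: lp_def)
  qed
  then show "T \<in> summing_type_maps sE sF n p"
    using T by (simp add: summing_type_maps_def absolutely_summing_def)
qed

text \<open>Equal exponents \<open>n\<close> raise the inner exponent to \<open>n * p\<close> and
  leave outer powers \<open>1 / n\<close>, which combine with \<open>1 / p\<close> to
  \<open>1 / (n * p)\<close>. Each resulting factor depends on one functional only, so the joint
  measure may be replaced by its marginals.\<close>

lemma semi_integral_subset_dominated:
  assumes sE: "banach_over sE" and p: "0 < p" and n: "0 < n"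
  shows "semi_integral_maps sE sF n p \<subseteq> dominated_maps sE sF n (real n * p)"
proof
  fix T assume "T \<in> semi_integral_maps sE sF n p"
  then obtain C \<mu> where T: "T \<in> cont_multilinear_maps sE sF {..<n}" and C: "C \<ge> 0"
    and \<mu>: "regular_borel_prob (product_topology (\<lambda>_. dual_ball_topology sE) {..<n}) \<mu>"
    and TC: "\<And>x. norm (T x) \<le> C * (\<integral>\<phi>. (\<Prod>j<n. norm (\<phi> j (x j)) powr p) \<partial>\<mu>) powr (1 / p)"
    using semi_integralD by blast
  let ?X = "dual_ball_topology sE" and ?np = "real n * p"
  define \<nu> where "\<nu> j = distr \<mu> (borel_of ?X) (\<lambda>\<phi>. \<phi> j)" for j
  have proj: "continuous_map (product_topology (\<lambda>_. ?X) {..<n}) ?X (\<lambda>\<phi>. \<phi> j)" if "j < n" for j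
    using that continuous_map_product_projection[of j "{..<n}" "\<lambda>_. ?X"] by simp
  have \<nu>: "regular_borel_prob ?X (\<nu> j)" if "j < n" for j
    unfolding \<nu>_def by (rule regular_borel_prob_distr[OF \<mu> proj[OF that] Hausdorff_dual_ball_topology])
  have marginal: "(\<integral>\<phi>. norm (\<phi> y) powr ?np \<partial>\<nu> j) = (\<integral>\<phi>. norm (\<phi> j y) powr ?np \<partial>\<mu>)" if "j < n" for j y
  proof -
    have "(\<lambda>\<phi>. \<phi> j) \<in> \<mu> \<rightarrow>\<^sub>M borel_of ?X"
      using continuous_map_measurable_borel_of[OF proj[OF that]] regular_borel_probD(2)[OF \<mu>] measurable_cong_sets
      by blast
    moreover have "(\<lambda>\<phi>. norm (\<phi> y) powr ?np) \<in> borel_measurable (borel_of ?X)"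
    proof -
      have "(\<lambda>\<phi>. \<phi> y) \<in> borel_measurable (borel_of ?X)"
        by (intro continuous_map_borel_measurable continuous_map_dual_ball_eval)
      then show ?thesis by measurable
    qed
    ultimately show ?thesis unfolding \<nu>_def by (rule integral_distr)
  qed
  have "norm (T x) \<le> C * (\<Prod>j<n. (\<integral>\<phi>. norm (\<phi> (x j)) powr ?np \<partial>\<nu> j) powr (1 / ?np))" for x
  proof -
    have pow: "(norm (\<phi> j y) powr p) powr real n = norm (\<phi> j y) powr ?np" for \<phi> :: "nat \<Rightarrow> _ \<Rightarrow> _" and j y
      by (simp add: powr_powr mult.commute)
    have "(\<integral>\<phi>. (\<Prod>j<n. norm (\<phi> j (x j)) powr p) \<partial>\<mu>) \<le>
      (\<Prod>j<n. (\<integral>\<phi>. (norm (\<phi> j (x j)) powr p) powr real (card {..<n}) \<partial>\<mu>) powr (1 / real (card {..<n})))"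
    proof (rule Hoelder_prod_powr)
      show "{..<n} \<noteq> {}" using n by auto
      show "(\<lambda>\<phi>. norm (\<phi> j (x j)) powr p) \<in> borel_measurable \<mu>" if "j \<in> {..<n}" for j
        using that by (intro semi_integral_measurable[OF sE \<mu>]) simp
      show "integrable \<mu> (\<lambda>\<phi>. (norm (\<phi> j (x j)) powr p) powr real (card {..<n}))" if "j \<in> {..<n}" for j
        using semi_integral_integrable_prod[OF sE \<mu>, of "{j}" ?np x] that p by (simp add: pow)
    qed auto
    also have "\<dots> = (\<Prod>j<n. (\<integral>\<phi>. norm (\<phi> (x j)) powr ?np \<partial>\<nu> j) powr (1 / real n))"
      by (intro prod.cong) (simp_all add: pow marginal)
    finally have "(\<integral>\<phi>. (\<Prod>j<n. norm (\<phi> j (x j)) powr p) \<partial>\<mu>) powr (1 / p) \<le> \<dots> powr (1 / p)"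
      using p by (intro powr_mono2 Bochner_Integration.integral_nonneg prod_nonneg) auto
    also have "\<dots> = (\<Prod>j<n. (\<integral>\<phi>. norm (\<phi> (x j)) powr ?np \<partial>\<nu> j) powr (1 / ?np))"
      by (simp add: prod_powr_distrib powr_powr)
    finally have "C * (\<integral>\<phi>. (\<Prod>j<n. norm (\<phi> j (x j)) powr p) \<partial>\<mu>) powr (1 / p) \<le> C * \<dots>"
      using C by (rule mult_left_mono)
    with TC[of x] show ?thesis by linarith
  qed
  then show "T \<in> dominated_maps sE sF n ?np"
    unfolding dominated_maps_def using T C \<nu> by blast
qed

lemma semi_integral_subset_fully_summing:
  assumes sE: "banach_over sE" and p: "0 < p"
  shows "semi_integral_maps sE sF n p \<subseteq> fully_summing_maps sE sF n p"
proof
  fix T assume "T \<in> semi_integral_maps sE sF n p"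
  then obtain C \<mu> where T: "T \<in> cont_multilinear_maps sE sF {..<n}" and C: "C \<ge> 0"
    and \<mu>: "regular_borel_prob (product_topology (\<lambda>_. dual_ball_topology sE) {..<n}) \<mu>"
    and TC: "\<And>x. norm (T x) \<le> C * (\<integral>\<phi>. (\<Prod>j<n. norm (\<phi> j (x j)) powr p) \<partial>\<mu>) powr (1 / p)"
    using semi_integralD by blast
  \<comment> \<open>Full summability asks for a positive constant, while \<open>C\<close> is only
    nonnegative; hence \<open>C + 1\<close>.\<close>
  have "(\<lambda>j. norm (T (\<lambda>k. x k (j k))) powr p) summable_on ({..<n} \<rightarrow>\<^sub>E UNIV) \<and>
      (\<Sum>\<^sub>\<infinity>j\<in>{..<n} \<rightarrow>\<^sub>E UNIV. norm (T (\<lambda>k. x k (j k))) powr p) powr (1 / p)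
        \<le> (C + 1) * (\<Prod>k<n. weak_lp_norm sE p (x k))"
    if x: "\<forall>k<n. x k \<in> weak_lp sE (ereal p)" for x
  proof -
    let ?t = "\<lambda>j. norm (T (\<lambda>k. x k (j k))) powr p"
    define W where "W k = weak_lp_norm sE p (x k)" for k
    have W0: "0 \<le> W k" if "k < n" for k
      using weak_lp_norm_nonneg_bound(1)[OF sE p] x that by (simp add: W_def)
    define D where "D = (\<Prod>k<n. W k powr p)"
    have D0: "0 \<le> D" by (simp add: D_def prod_nonneg)
    have bound: "(\<Sum>j\<in>A. ?t j) \<le> C powr p * D" if A: "A \<subseteq> {..<n} \<rightarrow>\<^sub>E UNIV" "finite A" for A
    proof (rule semi_integral_sum_le[OF sE \<mu> p C D0 A(2), where J="{..<n}"])
      show "norm (T (\<lambda>k. x k (j k))) \<le> C * (\<integral>\<phi>. (\<Prod>k<n. norm (\<phi> k (x k (j k))) powr p) \<partial>\<mu>) powr (1 / p)" for j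
        by (rule TC)
      fix \<phi> assume \<phi>: "\<phi> \<in> space \<mu>"
      \<comment> \<open>A finite set of multi-indices lies in a cube, and over a cube the sum of
        products is a product of sums.\<close>
      have "finite (\<Union>j\<in>A. j ` {..<n})" using A(2) by blast
      then obtain N where N: "(\<Union>j\<in>A. j ` {..<n}) \<subseteq> {..<N}" using finite_nat_bounded by blast
      have "A \<subseteq> {..<n} \<rightarrow>\<^sub>E {..<N}"
      proof
        fix j assume "j \<in> A"
        then show "j \<in> {..<n} \<rightarrow>\<^sub>E {..<N}" using A(1) N by (force simp: PiE_iff)
      qed
      then have "(\<Sum>j\<in>A. \<Prod>k<n. norm (\<phi> k (x k (j k))) powr p) \<le>
          (\<Sum>j\<in>{..<n} \<rightarrow>\<^sub>E {..<N}. \<Prod>k<n. norm (\<phi> k (x k (j k))) powr p)"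
        by (intro sum_mono2 finite_PiE prod_nonneg) auto
      also have "\<dots> = (\<Prod>k<n. \<Sum>m<N. norm (\<phi> k (x k m)) powr p)"
        by (rule prod_sum_PiE[symmetric]) auto
      also have "\<dots> \<le> D"
        unfolding D_def W_def
        using weak_lp_norm_nonneg_bound(2)[OF sE p] x semi_integral_component[OF sE \<mu> \<phi>]
        by (intro prod_mono conjI sum_nonneg) auto
      finally show "(\<Sum>j\<in>A. \<Prod>k<n. norm (\<phi> k (x k (j k))) powr p) \<le> D" .
    qed auto
    have summ: "?t summable_on ({..<n} \<rightarrow>\<^sub>E UNIV)"
      using bound by (intro nonneg_bdd_above_summable_on bdd_aboveI2[where M="C powr p * D"]) auto
    have "(\<Sum>\<^sub>\<infinity>j\<in>{..<n} \<rightarrow>\<^sub>E UNIV. ?t j) \<le> C powr p * D"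
      using bound by (intro infsum_le_finite_sums[OF summ]) auto
    then have "(\<Sum>\<^sub>\<infinity>j\<in>{..<n} \<rightarrow>\<^sub>E UNIV. ?t j) powr (1 / p) \<le> (C powr p * D) powr (1 / p)"
      using p by (intro powr_mono2 infsum_nonneg) auto
    also have "\<dots> = C * (\<Prod>k<n. W k)"
    proof -
      have "D powr (1 / p) = (\<Prod>k<n. W k)"
        unfolding D_def prod_powr_distrib using p W0 by (intro prod.cong) (simp_all add: powr_powr)
      then show ?thesis using p C by (simp add: powr_mult powr_powr)
    qed
    also have "\<dots> \<le> (C + 1) * (\<Prod>k<n. W k)"
      using W0 by (intro mult_right_mono prod_nonneg) auto
    finally show ?thesis using summ by (simp add: W_def)
  qed
  then show "T \<in> fully_summing_maps sE sF n p"
    unfolding fully_summing_maps_def using T C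
    by (intro CollectI conjI exI[of _ "C + 1"]) auto
qed

section \<open>From full summability to summability at every point\<close>

lemma lp_sum:
  fixes f :: "'i \<Rightarrow> nat \<Rightarrow> 'f::real_normed_vector"
  assumes p: "0 < p" and "finite A" "\<And>a. a \<in> A \<Longrightarrow> f a \<in> lp norm p"
  shows "(\<lambda>m. \<Sum>a\<in>A. f a m) \<in> lp norm p"
  using assms(2,3)
proof (induction A)
  case (insert a A)
  have sm: "summable (\<lambda>m. 2 powr p * (norm (f a m) powr p + norm (\<Sum>a\<in>A. f a m) powr p))"
    using insert by (intro summable_mult summable_add) (auto simp: lp_def)
  have "norm (f a m + (\<Sum>a\<in>A. f a m)) powr p \<le>
      2 powr p * (norm (f a m) powr p + norm (\<Sum>a\<in>A. f a m) powr p)" for m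
  proof -
    have "norm (f a m + (\<Sum>a\<in>A. f a m)) powr p \<le> (norm (f a m) + norm (\<Sum>a\<in>A. f a m)) powr p"
      using p by (intro powr_mono2 norm_triangle_ineq) auto
    also have "\<dots> \<le> 2 powr p * (norm (f a m) powr p + norm (\<Sum>a\<in>A. f a m) powr p)"
      using p by (intro powr_add_le) auto
    finally show ?thesis .
  qed
  then have "summable (\<lambda>m. norm (f a m + (\<Sum>a\<in>A. f a m)) powr p)"
    by (intro summable_comparison_test'[OF sm, of 0]) simp
  then show ?case using insert.hyps by (simp add: lp_def)
qed (simp add: lp_def)

text \<open>In the expansion at \<open>a\<close> the term that takes nothing from the sequences is
  \<open>T a\<close> and cancels, so only nonempty \<open>S\<close> remain.\<close>

lemma fully_summing_subset_as_ev:
  assumes sE: "banach_over sE" and sF: "banach_over sF" and p: "0 < p"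
  shows "fully_summing_maps sE sF n p \<subseteq> as_ev_maps sE sF n p (\<lambda>_. ereal p)"
proof
  fix T assume "T \<in> fully_summing_maps sE sF n p"
  then have T: "T \<in> cont_multilinear_maps sE sF {..<n}"
    and full: "\<And>x. \<forall>k<n. x k \<in> weak_lp sE (ereal p) \<Longrightarrow>
      (\<lambda>j. norm (T (\<lambda>k. x k (j k))) powr p) summable_on ({..<n} \<rightarrow>\<^sub>E UNIV)"
    unfolding fully_summing_maps_def by blast+
  interpret F: banach_over sF by fact
  have ml: "T \<in> multilinear_maps sE sF {..<n}" using T by (simp add: cont_multilinear_maps_def)
  have "(\<lambda>m. T (\<lambda>s. a s + x s m) - T a) \<in> lp norm p"
    if x: "\<forall>s<n. x s \<in> weak_lp sE (ereal p)" for a x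
  proof -
    let ?v = "\<lambda>S m i. if i \<in> S then x i m else a i"
    have part: "(\<lambda>m. T (?v S m)) \<in> lp norm p" if S: "S \<in> Pow {..<n} - {{}}" for S
    proof -
      \<comment> \<open>Testing the full sum on the sequences \<open>(a i, 0, 0, \<dots>)\<close> for \<open>i\<close> outside \<open>S\<close> and
        restricting it to the multi-indices that are constant on \<open>S\<close> and zero elsewhere.\<close>
      define y where "y k = (if k \<in> S then x k else (\<lambda>m. if m = 0 then a k else 0))" for k
      define idx where "idx m = (\<lambda>k\<in>{..<n}. if k \<in> S then m else (0::nat))" for m
      have "y k \<in> weak_lp sE (ereal p)" if "k < n" for k
      proof (cases "k \<in> S")
        case False
        have "summable (\<lambda>m. norm (\<phi> (if m = 0 then a k else 0)) powr p)" if "\<phi> \<in> dual_space sE" for \<phi>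
        proof -
          have "\<phi> 0 = 0" using that by (simp add: dual_space_iff[OF sE] linear_simps)
          then show ?thesis by (intro summable_finite[of "{0}"]) auto
        qed
        then show ?thesis using False by (simp add: y_def weak_lp_def lp_def)
      qed (use x that in \<open>simp add: y_def\<close>)
      then have "(\<lambda>j. norm (T (\<lambda>k. y k (j k))) powr p) summable_on ({..<n} \<rightarrow>\<^sub>E UNIV)"
        using full by blast
      then have "(\<lambda>j. norm (T (\<lambda>k. y k (j k))) powr p) summable_on range idx"
        by (rule summable_on_subset_banach) (auto simp: idx_def split: if_splits)
      \<comment> \<open>Nonemptiness of \<open>S\<close> enters here: a coordinate in
        \<open>S\<close> recovers \<open>m\<close> from the multi-index.\<close>
      moreover have "inj idx"
      proof (rule injI)
        fix m m' assume eq: "idx m = idx m'"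
        obtain s where "s \<in> S" "s < n" using S by blast
        then show "m = m'" using fun_cong[OF eq, of s] by (simp add: idx_def)
      qed
      ultimately have "((\<lambda>j. norm (T (\<lambda>k. y k (j k))) powr p) \<circ> idx) summable_on UNIV"
        by (simp add: summable_on_reindex)
      moreover have "T (\<lambda>k. y k (idx m k)) = T (?v S m)" for m
        using ml by (rule multilinear_cong) (auto simp: y_def idx_def)
      ultimately have "(\<lambda>m. norm (T (?v S m)) powr p) summable_on UNIV" by (simp add: comp_def)
      then show ?thesis by (simp add: lp_def summable_on_UNIV_nonneg_real_iff)
    qed
    have "T (\<lambda>s. a s + x s m) - T a = (\<Sum>S\<in>Pow {..<n} - {{}}. T (?v S m))" for m
    proof -
      have "T (\<lambda>s. a s + x s m) = T (\<lambda>i. if i \<in> {..<n} then a i + x i m else a i)"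
        using ml by (rule multilinear_cong) simp
      also have "\<dots> = (\<Sum>S\<in>Pow {..<n}. T (?v S m))"
        by (rule multilinear_add_expand[OF sE F.vector_space_axioms ml]) auto
      also have "\<dots> = T (?v {} m) + (\<Sum>S\<in>Pow {..<n} - {{}}. T (?v S m))"
        by (rule sum.remove) auto
      finally show ?thesis by simp
    qed
    moreover have "(\<lambda>m. \<Sum>S\<in>Pow {..<n} - {{}}. T (?v S m)) \<in> lp norm p"
      using part by (intro lp_sum p) auto
    ultimately show ?thesis by simp
  qed
  then show "T \<in> as_ev_maps sE sF n p (\<lambda>_. ereal p)"
    using T by (simp add: as_ev_maps_def summing_at_def)
qed

text \<open>Under the image measure, evaluation at \<open>x\<close> becomes the product of the
  evaluations at the \<open>x j\<close>, so the same constant \<open>C\<close> works.\<close>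

lemma semi_integral_subset_strongly_summing:
  assumes sE: "banach_over sE" and p: "0 < p"
  shows "semi_integral_maps sE sF n p \<subseteq> strongly_summing_maps sE sF n p"
proof
  fix T assume "T \<in> semi_integral_maps sE sF n p"
  then obtain C \<mu> where T: "T \<in> cont_multilinear_maps sE sF {..<n}" and C: "C \<ge> 0"
    and \<mu>: "regular_borel_prob (product_topology (\<lambda>_. dual_ball_topology sE) {..<n}) \<mu>"
    and TC: "\<And>x. norm (T x) \<le> C * (\<integral>\<phi>. norm (\<Prod>j<n. \<phi> j (x j)) powr p \<partial>\<mu>) powr (1 / p)"
    unfolding semi_integral_maps_def by blast
  let ?Y = "multiform_ball_topology sE {..<n}"
  define \<nu> where "\<nu> = distr \<mu> (borel_of ?Y) (tensor_form n)"
  have ct: "continuous_map (product_topology (\<lambda>_. dual_ball_topology sE) {..<n}) ?Y (tensor_form n)"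
    by (rule continuous_map_tensor_form[OF sE])
  have \<nu>: "regular_borel_prob ?Y \<nu>"
    unfolding \<nu>_def by (rule regular_borel_prob_distr[OF \<mu> ct Hausdorff_multiform_ball_topology])
  have "(\<integral>\<phi>. norm (\<phi> x) powr p \<partial>\<nu>) = (\<integral>\<phi>. norm (\<Prod>j<n. \<phi> j (x j)) powr p \<partial>\<mu>)" for x
  proof -
    have "tensor_form n \<in> \<mu> \<rightarrow>\<^sub>M borel_of ?Y"
      using continuous_map_measurable_borel_of[OF ct] regular_borel_probD(2)[OF \<mu>] measurable_cong_sets
      by blast
    moreover have "(\<lambda>\<phi>. norm (\<phi> x) powr p) \<in> borel_measurable (borel_of ?Y)"
    proof -
      have "(\<lambda>\<phi>. \<phi> x) \<in> borel_measurable (borel_of ?Y)"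
        by (intro continuous_map_borel_measurable continuous_map_multiform_eval)
      then show ?thesis by measurable
    qed
    ultimately have "(\<integral>\<phi>. norm (\<phi> x) powr p \<partial>\<nu>) = (\<integral>\<phi>. norm (tensor_form n \<phi> x) powr p \<partial>\<mu>)"
      unfolding \<nu>_def by (rule integral_distr)
    then show ?thesis by (simp add: tensor_form_def)
  qed
  then show "T \<in> strongly_summing_maps sE sF n p"
    unfolding strongly_summing_maps_def using T C \<nu> TC
    by (intro CollectI conjI exI[of _ C] exI[of _ \<nu>]) auto
qed

theorem theorem4:
  fixes sE :: "'k::real_or_complex \<Rightarrow> 'e::banach \<Rightarrow> 'e"
    and sF :: "'k \<Rightarrow> 'f::banach \<Rightarrow> 'f"
    and n :: nat and p :: real
  assumes "banach_over sE" and "banach_over sF" and "n \<ge> 2" and "0 < p"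
  shows
    "(summing_type_maps sE sF n p =
           (\<Inter>j\<in>{..<n}. as_maps sE sF n p (\<lambda>s. if s = j then ereal p else \<infinity>))) \<and>
     (dominated_maps sE sF n p \<subseteq> semi_integral_maps sE sF n p) \<and>
     (semi_integral_maps sE sF n p \<subseteq> summing_type_maps sE sF n p) \<and>
     (semi_integral_maps sE sF n p \<subseteq> dominated_maps sE sF n (real n * p)) \<and>
     (semi_integral_maps sE sF n p \<subseteq> fully_summing_maps sE sF n p) \<and>
     (fully_summing_maps sE sF n p \<subseteq> as_ev_maps sE sF n p (\<lambda>_. ereal p)) \<and>
     (as_ev_maps sE sF n p (\<lambda>_. ereal p) \<subseteq> as_maps sE sF n p (\<lambda>_. ereal p)) \<and>
     (semi_integral_maps sE sF n p \<subseteq> strongly_summing_maps sE sF n p)"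
proof (intro conjI)
  have n: "0 < n" using assms by simp
  show "summing_type_maps sE sF n p =
      (\<Inter>j\<in>{..<n}. as_maps sE sF n p (\<lambda>s. if s = j then ereal p else \<infinity>))"
    using summing_type_subset_as_maps[OF assms(1,2,4)]
      as_maps_subset_summing_type[OF assms(1,2,4) n] by (intro equalityI INT_greatest) auto
  show "dominated_maps sE sF n p \<subseteq> semi_integral_maps sE sF n p"
    by (rule dominated_subset_semi_integral[OF assms(1,4)])
  show "semi_integral_maps sE sF n p \<subseteq> summing_type_maps sE sF n p"
    by (rule semi_integral_subset_summing_type[OF assms(1,2,4)])
  show "semi_integral_maps sE sF n p \<subseteq> dominated_maps sE sF n (real n * p)"
    by (rule semi_integral_subset_dominated[OF assms(1,4) n])
  show "semi_integral_maps sE sF n p \<subseteq> fully_summing_maps sE sF n p"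
    by (rule semi_integral_subset_fully_summing[OF assms(1,4)])
  show "fully_summing_maps sE sF n p \<subseteq> as_ev_maps sE sF n p (\<lambda>_. ereal p)"
    by (rule fully_summing_subset_as_ev[OF assms(1,2,4)])
  show "as_ev_maps sE sF n p (\<lambda>_. ereal p) \<subseteq> as_maps sE sF n p (\<lambda>_. ereal p)"
    by (auto simp: as_ev_maps_def as_maps_def)
  show "semi_integral_maps sE sF n p \<subseteq> strongly_summing_maps sE sF n p"
    by (rule semi_integral_subset_strongly_summing[OF assms(1,4)])
qed

end
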